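(* Let $s\in(0,1)$ be the root of $s^3=(1-s)^3+3s(1-s)^2$ (so $s\approx .653$) and let $r=s^3\approx .278$. There is a neighborhood of the point $(r,r)$ in the feasible region for the patterns $123$ and $321$ within which no permuton has $12$-density near $\frac12$; that is, there exist a neighborhood $N$ of $(r,r)$ in the set $\{(\rho_{123}(\gamma),\rho_{321}(\gamma)):\gamma\text{ a permuton}\}$ and $\eta>0$ such that every permuton $\gamma$ with $(\rho_{123}(\gamma),\rho_{321}(\gamma))\in N$ satisfies $|\rho_{12}(\gamma)-\tfrac12|\ge\eta$.
   Context: A permuton is a Borel probability measure $\gamma$ on $[0,1]^2$ with uniform marginals. For $\tau\in S_m$, the pattern density $\rho_\tau(\gamma)$ is the probability that, when $m$ points are selected independently from $\gamma$ and ordered by their $x$-coordinates, the permutation induced by their $y$-coordinates is $\tau$. *)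

theory Defs
  imports "HOL-Probability.Probability" "HOL-Combinatorics.Permutations"
begin

definition permuton :: "(real \<times> real) measure \<Rightarrow> bool" where
  "permuton \<gamma> \<longleftrightarrow>
     prob_space \<gamma> \<and>
     sets \<gamma> = sets (restrict_space borel ({0..1} \<times> {0..1})) \<and>
     distr \<gamma> borel fst = uniform_measure lborel {0..1} \<and>
     distr \<gamma> borel snd = uniform_measure lborel {0..1}"

text \<open>
  A permutation in \<open>S\<^sub>m\<close> is given by its one-line notation, a list of length \<open>m\<close>; only the
  relative order of its entries matters. The points \<open>p 0, \<dots>, p (m - 1)\<close> come in arbitrary
  order, and \<open>\<sigma>\<close> sorts them by \<open>x\<close>-coordinate. Both coordinates are required to be free of
  ties, which for a sample from a permuton holds almost surely.
\<close>

definition induces :: "(nat \<Rightarrow> real \<times> real) \<Rightarrow> nat list \<Rightarrow> bool" where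
  "induces p \<tau> \<longleftrightarrow>
     (\<exists>\<sigma>. \<sigma> permutes {..<length \<tau>} \<and>
        (\<forall>i<length \<tau>. \<forall>j<length \<tau>. i < j \<longrightarrow> fst (p (\<sigma> i)) < fst (p (\<sigma> j))) \<and>
        (\<forall>i<length \<tau>. \<forall>j<length \<tau>.
            snd (p (\<sigma> i)) < snd (p (\<sigma> j)) \<longleftrightarrow> \<tau> ! i < \<tau> ! j))"

definition pattern_density :: "nat list \<Rightarrow> (real \<times> real) measure \<Rightarrow> real" where
  "pattern_density \<tau> \<gamma> =
     (let M = Pi\<^sub>M {..<length \<tau>} (\<lambda>_. \<gamma>) in measure M {p \<in> space M. induces p \<tau>})"

definition feasible_region :: "nat list \<Rightarrow> nat list \<Rightarrow> (real \<times> real) set" where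
  "feasible_region \<tau>\<^sub>1 \<tau>\<^sub>2 =
     {(pattern_density \<tau>\<^sub>1 \<gamma>, pattern_density \<tau>\<^sub>2 \<gamma>) | \<gamma>. permuton \<gamma>}"

lemma sets_induces:
  assumes "permuton \<gamma>"
  shows "{p \<in> space (Pi\<^sub>M {..<length \<tau>} (\<lambda>_. \<gamma>)). induces p \<tau>}
           \<in> sets (Pi\<^sub>M {..<length \<tau>} (\<lambda>_. \<gamma>))"
proof -
  let ?A = "{..<length \<tau>}"
  let ?M = "Pi\<^sub>M ?A (\<lambda>_. \<gamma>)"
  have sets_eq: "sets \<gamma> = sets (restrict_space borel ({0..1} \<times> {0..1}))"
    using assms by (simp add: permuton_def)
  have coords: "fst \<in> borel_measurable \<gamma>" "snd \<in> borel_measurable \<gamma>"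
    by (auto simp: measurable_cong_sets[OF sets_eq refl] borel_prod[symmetric]
             intro!: measurable_restrict_space1)
  have comp: "(\<lambda>p. fst (p k)) \<in> borel_measurable ?M" "(\<lambda>p. snd (p k)) \<in> borel_measurable ?M"
    if "k \<in> ?A" for k
    using that by (auto intro: measurable_compose[OF measurable_component_singleton] coords)
  have fin: "finite {\<sigma>. \<sigma> permutes ?A}"
    by (rule finite_permutations) simp
  let ?P = "\<lambda>\<sigma> p i j. i < j \<longrightarrow> fst (p (\<sigma> i)) < fst (p (\<sigma> j))"
  let ?Q = "\<lambda>\<sigma> p i j. snd (p (\<sigma> i)) < snd (p (\<sigma> j)) \<longleftrightarrow> \<tau> ! i < \<tau> ! j"
  have ij: "Measurable.pred ?M (\<lambda>p. ?P \<sigma> p i j)" "Measurable.pred ?M (\<lambda>p. ?Q \<sigma> p i j)"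
    if "\<sigma> permutes ?A" "i \<in> ?A" "j \<in> ?A" for \<sigma> i j
  proof -
    have i: "\<sigma> i \<in> ?A" and j: "\<sigma> j \<in> ?A"
      using that by (simp_all only: permutes_in_image)
    note [measurable] = comp[OF i] comp[OF j]
    show "Measurable.pred ?M (\<lambda>p. ?P \<sigma> p i j)" "Measurable.pred ?M (\<lambda>p. ?Q \<sigma> p i j)"
      by measurable
  qed
  have "Measurable.pred ?M (\<lambda>p. (\<forall>i\<in>?A. \<forall>j\<in>?A. ?P \<sigma> p i j) \<and> (\<forall>i\<in>?A. \<forall>j\<in>?A. ?Q \<sigma> p i j))"
    if "\<sigma> permutes ?A" for \<sigma>
    by (rule pred_intros_logic(3); rule pred_intros_finite(3)[OF finite_lessThan];
        rule pred_intros_finite(3)[OF finite_lessThan]; rule ij[OF that]; assumption)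
  then have "Measurable.pred ?M (\<lambda>p. \<exists>\<sigma>\<in>{\<sigma>. \<sigma> permutes ?A}.
      (\<forall>i\<in>?A. \<forall>j\<in>?A. ?P \<sigma> p i j) \<and> (\<forall>i\<in>?A. \<forall>j\<in>?A. ?Q \<sigma> p i j))"
    by (rule pred_intros_finite(4)[OF fin]) (simp only: mem_Collect_eq)
  moreover have "induces p \<tau> \<longleftrightarrow> (\<exists>\<sigma>\<in>{\<sigma>. \<sigma> permutes ?A}.
      (\<forall>i\<in>?A. \<forall>j\<in>?A. ?P \<sigma> p i j) \<and> (\<forall>i\<in>?A. \<forall>j\<in>?A. ?Q \<sigma> p i j))" for p
    unfolding induces_def by (simp only: Bex_def Ball_def mem_Collect_eq lessThan_iff)
  ultimately show ?thesis
    by (simp only: pred_def)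
qed

lemma ex1_root: "\<exists>!s::real. 0 < s \<and> s < 1 \<and> s ^ 3 = (1 - s) ^ 3 + 3 * s * (1 - s)\<^sup>2"
proof -
  have eq: "s ^ 3 = (1 - s) ^ 3 + 3 * s * (1 - s)\<^sup>2 \<longleftrightarrow> s ^ 3 - 3 * s\<^sup>2 + 1 = 0" for s :: real
    by (simp add: power2_eq_square power3_eq_cube algebra_simps; linarith)
  have "\<exists>s\<ge>0. s \<le> (1::real) \<and> s ^ 3 - 3 * s\<^sup>2 + 1 = 0"
    by (rule IVT2) (auto intro!: continuous_intros)
  then obtain s :: real where s: "0 \<le> s" "s \<le> 1" "s ^ 3 - 3 * s\<^sup>2 + 1 = 0"
    by blast
  moreover from s(3) have "s \<noteq> 0" "s \<noteq> 1"
    by auto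
  ultimately have s': "0 < s" "s < 1"
    by auto
  have "t = s" if t: "0 < t" "t < 1" "t ^ 3 - 3 * t\<^sup>2 + 1 = 0" for t
  proof -
    have "t * (3 - t - s) + s * (3 - s) > 0"
      using s' t by (intro add_pos_pos mult_pos_pos) auto
    moreover have "(t - s) * (t * (3 - t - s) + s * (3 - s)) = 0"
      using s(3) t(3) by (simp add: power2_eq_square power3_eq_cube algebra_simps)
    ultimately show ?thesis
      by simp
  qed
  then show ?thesis
    using s(3) s' unfolding eq by blast
qed

end

theory Submission imports Defs begin

text \<open>
  Two points of a permuton \<open>\<gamma>\<close> are adjacent in its comparability graph if they are concordant, that
  is, if the one with the larger \<open>x\<close>-coordinate also has the larger \<open>y\<close>-coordinate. The density of
  \<open>12\<close> is then the edge density \<open>e\<close>, the density of \<open>123\<close> is the triangle density \<open>c\<close>, and, ties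
  having probability zero, the density of \<open>321\<close> is the density \<open>i\<close> of independent triples. The
  theorem is a fact about arbitrary symmetric kernels with values in \<open>[0, 1]\<close>
  (\<open>clique_or_independent_density_small\<close>): if \<open>\<bar>e - 1 / 2\<bar> \<le> 1 / 1000\<close> then \<open>c\<close> or \<open>i\<close> is at most
  \<open>0.278\<close>. Since \<open>r\<close> exceeds \<open>0.278\<close>, the quadrant where both coordinates exceed \<open>0.278\<close> cuts out the
  neighbourhood \<open>N\<close>. The point \<open>(r, r)\<close> itself is attained by a decreasing block of length \<open>s\<close>
  followed by an increasing one (\<open>pattern_density_block\<close>).

  No linear inequality between \<open>c\<close> and \<open>i\<close> can give the bound at \<open>e = 1 / 2\<close>: a clique on measure
  \<open>1 / sqrt 2\<close> with all other vertices isolated has \<open>c\<close> about \<open>0.354\<close> and \<open>i\<close> about \<open>0.207\<close>, its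
  complement has the two values exchanged, and their average \<open>0.280\<close> is larger than \<open>r\<close>. The two
  graphs are told apart by a cut in the degrees. There is a level \<open>\<alpha>\<close> such that the vertices of
  degree above \<open>\<alpha>\<close>, together with a suitable fraction of those of degree exactly \<open>\<alpha>\<close>, have total
  measure \<open>\<alpha>\<close> (\<open>exists_fractional_cut\<close>); passing to the complement one may assume \<open>\<alpha> \<ge> 1 / 2\<close>.
  Let \<open>T\<close> be this top part, \<open>S\<close> its complement, \<open>\<beta> = 1 - \<alpha>\<close>, and, with \<open>d\<close> the degree,
  \<open>v\<close> the integral of \<open>d - \<alpha>\<close> over \<open>T\<close> and \<open>l\<close> the integral of \<open>d\<close> over \<open>S\<close>. Then
  \<open>e = \<alpha>\<^sup>2 + v + l\<close>, and \<open>v \<le> l\<close> because at most \<open>\<alpha>\<close> of the degree of a top vertex goes to \<open>T\<close>.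

  Goodman's identity expresses \<open>c + i\<close> by \<open>e\<close> and the integral of \<open>d\<^sup>2\<close>, which is bounded
  in two ways. Pointwise, \<open>(d - \<alpha>)\<^sup>2 \<le> \<beta> (d - \<alpha>)\<close> on \<open>T\<close> and \<open>d\<^sup>2 \<le> \<alpha> d\<close> on \<open>S\<close>. A second bound
  (\<open>sum_squares_codegree_bound\<close>) uses that the square of the degree of a top vertex into \<open>S\<close> counts
  pairs of its neighbours in \<open>S\<close>: a pair of vertices in \<open>S\<close> has no more common neighbours than
  the smaller of their degrees, so large squares on both sides of the cut exclude each other.
  Finally, an independent triple either lies in \<open>S\<close> or has a vertex in \<open>T\<close>, whose two partners are
  among its non-neighbours, which gives \<open>i \<le> \<beta>\<^sup>3 + 3 \<beta> (\<alpha> \<beta> - v)\<close>. For \<open>\<alpha> \<ge> 0.62\<close> a large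
  \<open>c + i\<close> forces \<open>v\<close> up by the pointwise bound and thereby \<open>i\<close> down (\<open>high_cut_bound\<close>); for
  \<open>\<alpha> \<le> 0.62\<close> the two bounds on the squares keep \<open>c + i\<close> at or below \<open>0.556\<close> (\<open>low_cut_bound\<close>).
\<close>

section \<open>Integrals over three independent points\<close>

abbreviation (in prob_space) M3 :: "('a \<times> 'a \<times> 'a) measure" where
  "M3 \<equiv> M \<Otimes>\<^sub>M (M \<Otimes>\<^sub>M M)"

definition (in prob_space) integral3 :: "('a \<Rightarrow> 'a \<Rightarrow> 'a \<Rightarrow> real) \<Rightarrow> real" where
  "integral3 f = (\<integral>x. \<integral>y. \<integral>z. f x y z \<partial>M \<partial>M \<partial>M)"

text \<open>
  Boundedness makes every integral below exist, and it is preserved by products and by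
  integrating out a coordinate. It is required on the space only, since inner
  integrals are controlled only there.
\<close>

definition (in prob_space) bounded3 :: "('a \<Rightarrow> 'a \<Rightarrow> 'a \<Rightarrow> real) \<Rightarrow> bool" where
  "bounded3 f \<longleftrightarrow> (\<lambda>(x, y, z). f x y z) \<in> borel_measurable M3 \<and>
     (\<exists>B. \<forall>x\<in>space M. \<forall>y\<in>space M. \<forall>z\<in>space M. \<bar>f x y z\<bar> \<le> B)"

context prob_space
begin

lemma integrable_bdd:
  fixes f :: "'a \<Rightarrow> real"
  assumes "f \<in> borel_measurable M" "\<And>x. x \<in> space M \<Longrightarrow> \<bar>f x\<bar> \<le> B"
  shows "integrable M f"
  by (rule integrable_const_bound[of _ B]) (use assms in auto)

lemma integral_bounded_abs:
  fixes f :: "'a \<Rightarrow> real"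
  assumes "integrable M f" "\<And>x. x \<in> space M \<Longrightarrow> \<bar>f x\<bar> \<le> B"
  shows "\<bar>\<integral>x. f x \<partial>M\<bar> \<le> B"
proof -
  have "\<bar>\<integral>x. f x \<partial>M\<bar> \<le> (\<integral>x. \<bar>f x\<bar> \<partial>M)"
    by (rule integral_abs_bound)
  also have "\<dots> \<le> B"
    using assms by (intro integral_le_const integrable_abs AE_I2) auto
  finally show ?thesis .
qed

lemma integral_swap:
  fixes f :: "'a \<Rightarrow> 'a \<Rightarrow> real"
  assumes "(\<lambda>(x, y). f x y) \<in> borel_measurable (M \<Otimes>\<^sub>M M)"
    "\<And>x y. x \<in> space M \<Longrightarrow> y \<in> space M \<Longrightarrow> \<bar>f x y\<bar> \<le> B"
  shows "(\<integral>x. \<integral>y. f x y \<partial>M \<partial>M) = (\<integral>x. \<integral>y. f y x \<partial>M \<partial>M)"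
proof -
  interpret pair_prob_space M M ..
  have "integrable (M \<Otimes>\<^sub>M M) (\<lambda>(x, y). f x y)"
    by (rule P.integrable_bdd[of _ B]) (use assms in \<open>auto simp: case_prod_beta space_pair_measure\<close>)
  from Fubini_integral[OF this] show ?thesis by simp
qed

lemma bounded3_measurable: "bounded3 f \<Longrightarrow> (\<lambda>(x, y, z). f x y z) \<in> borel_measurable M3"
  by (simp add: bounded3_def)

text \<open>
  The passage from iterated integrals, in which products of functions of separate coordinates
  factor by simplification, to a single integral, which gives linearity and monotonicity at once.
\<close>

lemma integral3_integral:
  assumes "bounded3 f"
  shows "integrable M3 (\<lambda>(x, y, z). f x y z)" "integral3 f = (\<integral>(x, y, z). f x y z \<partial>M3)"
proof -
  interpret MM: pair_prob_space M M ..
  interpret M3: pair_prob_space M "M \<Otimes>\<^sub>M M" ..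
  have [measurable]: "(\<lambda>(x, y, z). f x y z) \<in> borel_measurable M3"
    using assms by (simp add: bounded3_def)
  obtain B where B: "\<And>x y z. x \<in> space M \<Longrightarrow> y \<in> space M \<Longrightarrow> z \<in> space M \<Longrightarrow> \<bar>f x y z\<bar> \<le> B"
    using assms by (auto simp: bounded3_def)
  show int: "integrable M3 (\<lambda>(x, y, z). f x y z)"
    by (rule M3.P.integrable_bdd[of _ B]) (use B in \<open>auto simp: case_prod_beta space_pair_measure\<close>)
  have "(\<integral>y. \<integral>z. f x y z \<partial>M \<partial>M) = (\<integral>(y, z). f x y z \<partial>(M \<Otimes>\<^sub>M M))" if [measurable]: "x \<in> space M" for x
  proof -
    have "(\<lambda>(y, z). f x y z) \<in> borel_measurable (M \<Otimes>\<^sub>M M)"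
      by measurable
    then have "integrable (M \<Otimes>\<^sub>M M) (\<lambda>(y, z). f x y z)"
      by (rule MM.P.integrable_bdd[of _ B]) (use B that in \<open>auto simp: case_prod_beta space_pair_measure\<close>)
    from MM.integral_fst'[OF this] show ?thesis by simp
  qed
  then have "integral3 f = (\<integral>x. (\<integral>(y, z). f x y z \<partial>(M \<Otimes>\<^sub>M M)) \<partial>M)"
    unfolding integral3_def by (rule Bochner_Integration.integral_cong[OF refl])
  also have "\<dots> = (\<integral>(x, y, z). f x y z \<partial>M3)"
    using M3.integral_fst'[OF int] by simp
  finally show "integral3 f = (\<integral>(x, y, z). f x y z \<partial>M3)" .
qed

lemma bounded3_add: "bounded3 f \<Longrightarrow> bounded3 g \<Longrightarrow> bounded3 (\<lambda>x y z. f x y z + g x y z)"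
proof -
  assume f: "bounded3 f" and g: "bounded3 g"
  then obtain B C where "\<And>x y z. x \<in> space M \<Longrightarrow> y \<in> space M \<Longrightarrow> z \<in> space M \<Longrightarrow> \<bar>f x y z\<bar> \<le> B"
    "\<And>x y z. x \<in> space M \<Longrightarrow> y \<in> space M \<Longrightarrow> z \<in> space M \<Longrightarrow> \<bar>g x y z\<bar> \<le> C"
    unfolding bounded3_def by blast
  then have "x \<in> space M \<Longrightarrow> y \<in> space M \<Longrightarrow> z \<in> space M \<Longrightarrow> \<bar>f x y z + g x y z\<bar> \<le> B + C" for x y z
    by (meson abs_triangle_ineq add_mono order_trans)
  then show ?thesis
    using f g unfolding bounded3_def split_beta' by (intro conjI exI[of _ "B + C"]) auto
qed

lemma bounded3_mult: "bounded3 f \<Longrightarrow> bounded3 g \<Longrightarrow> bounded3 (\<lambda>x y z. f x y z * g x y z)"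
proof -
  assume f: "bounded3 f" and g: "bounded3 g"
  then obtain B C where "\<And>x y z. x \<in> space M \<Longrightarrow> y \<in> space M \<Longrightarrow> z \<in> space M \<Longrightarrow> \<bar>f x y z\<bar> \<le> B"
    "\<And>x y z. x \<in> space M \<Longrightarrow> y \<in> space M \<Longrightarrow> z \<in> space M \<Longrightarrow> \<bar>g x y z\<bar> \<le> C"
    unfolding bounded3_def by blast
  then have "x \<in> space M \<Longrightarrow> y \<in> space M \<Longrightarrow> z \<in> space M \<Longrightarrow> \<bar>f x y z * g x y z\<bar> \<le> B * C" for x y z
    unfolding abs_mult by (meson abs_ge_zero mult_mono order_trans)
  then show ?thesis
    using f g unfolding bounded3_def split_beta' by (intro conjI exI[of _ "B * C"]) auto
qed

lemma bounded3_const: "bounded3 (\<lambda>x y z. c)"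
  by (auto simp: bounded3_def)

lemma bounded3_diff: "bounded3 f \<Longrightarrow> bounded3 g \<Longrightarrow> bounded3 (\<lambda>x y z. f x y z - g x y z)"
  using bounded3_add[OF _ bounded3_mult[OF bounded3_const[of "-1"]], of f g] by simp

lemma bounded3_coord:
  assumes [measurable]: "h \<in> borel_measurable M" and "\<And>x. \<bar>h x\<bar> \<le> B"
  shows "bounded3 (\<lambda>x y z. h x)" "bounded3 (\<lambda>x y z. h y)" "bounded3 (\<lambda>x y z. h z)"
  using assms(2) unfolding bounded3_def case_prod_beta by (auto intro!: exI[of _ B])

lemma bounded3_pair:
  assumes [measurable]: "(\<lambda>(x, y). K x y) \<in> borel_measurable (M \<Otimes>\<^sub>M M)" and "\<And>x y. \<bar>K x y\<bar> \<le> B"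
  shows "bounded3 (\<lambda>x y z. K x y)" "bounded3 (\<lambda>x y z. K y z)" "bounded3 (\<lambda>x y z. K x z)"
        "bounded3 (\<lambda>x y z. K y x)" "bounded3 (\<lambda>x y z. K z y)" "bounded3 (\<lambda>x y z. K z x)"
  using assms(2) unfolding bounded3_def case_prod_beta by (auto intro!: exI[of _ B])

lemma integral3_add:
  "bounded3 f \<Longrightarrow> bounded3 g \<Longrightarrow> integral3 (\<lambda>x y z. f x y z + g x y z) = integral3 f + integral3 g"
  using Bochner_Integration.integral_add[OF integral3_integral(1)[of f] integral3_integral(1)[of g]]
  by (simp add: integral3_integral(2) bounded3_add split_beta')

lemma integral3_diff:
  "bounded3 f \<Longrightarrow> bounded3 g \<Longrightarrow> integral3 (\<lambda>x y z. f x y z - g x y z) = integral3 f - integral3 g"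
  using integral3_add[OF bounded3_diff[of f g], of g] by simp

lemma integral3_mono:
  "bounded3 f \<Longrightarrow> bounded3 g \<Longrightarrow>
   (\<And>x y z. x \<in> space M \<Longrightarrow> y \<in> space M \<Longrightarrow> z \<in> space M \<Longrightarrow> f x y z \<le> g x y z) \<Longrightarrow>
   integral3 f \<le> integral3 g"
  by (auto simp: integral3_integral space_pair_measure intro!: integral_mono)

text \<open>
  Kept in the form of a function of three arguments, so that estimates between functions in which
  one coordinate is already integrated out are again instances of \<open>integral3_mono\<close>.
\<close>

lemma bounded3_inner:
  assumes "bounded3 f"
  shows "bounded3 (\<lambda>x y z. \<integral>u. f x y u \<partial>M)"
    and "(\<lambda>(x, y). \<integral>u. f x y u \<partial>M) \<in> borel_measurable (M \<Otimes>\<^sub>M M)"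
proof -
  have [measurable]: "(\<lambda>(x, y, z). f x y z) \<in> borel_measurable M3"
    using assms by (simp add: bounded3_def)
  obtain B where B: "\<And>x y z. x \<in> space M \<Longrightarrow> y \<in> space M \<Longrightarrow> z \<in> space M \<Longrightarrow> \<bar>f x y z\<bar> \<le> B"
    using assms by (auto simp: bounded3_def)
  have B': "\<bar>\<integral>z. f x y z \<partial>M\<bar> \<le> B" if [measurable]: "x \<in> space M" "y \<in> space M" for x y
  proof -
    have [measurable]: "f x y \<in> borel_measurable M"
      by measurable
    have "integrable M (f x y)"
      by (rule integrable_bdd[of _ B]) (use B that in auto)
    then show ?thesis
      using B that by (intro integral_bounded_abs) auto
  qed
  have "(\<lambda>(p, z). f (fst p) (snd p) z) \<in> borel_measurable ((M \<Otimes>\<^sub>M M) \<Otimes>\<^sub>M M)"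
    using measurable_compose[of "\<lambda>(p, z). (fst p, snd p, z)" "(M \<Otimes>\<^sub>M M) \<Otimes>\<^sub>M M" M3
        "\<lambda>(x, y, z). f x y z" borel] bounded3_measurable[OF assms]
    by (simp add: split_beta')
  then show "(\<lambda>(x, y). \<integral>u. f x y u \<partial>M) \<in> borel_measurable (M \<Otimes>\<^sub>M M)"
    by (simp add: split_beta' borel_measurable_lebesgue_integral)
  then have [measurable]: "(\<lambda>p. \<integral>u. f (fst p) (snd p) u \<partial>M) \<in> borel_measurable (M \<Otimes>\<^sub>M M)"
    by (simp add: split_beta')
  have "(\<lambda>(x, y, z). \<integral>u. f x y u \<partial>M) \<in> borel_measurable M3"
    using measurable_compose[of "\<lambda>(x, y, z). (x, y)" M3 "M \<Otimes>\<^sub>M M"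
        "\<lambda>p. \<integral>u. f (fst p) (snd p) u \<partial>M" borel]
    by (simp add: split_beta')
  then show "bounded3 (\<lambda>x y z. \<integral>u. f x y u \<partial>M)"
    using B' unfolding bounded3_def by (intro conjI exI[of _ B]) auto
qed

lemma integral3_swap12:
  assumes "bounded3 f"
  shows "integral3 (\<lambda>x y z. f y x z) = integral3 f"
proof -
  obtain B where "\<And>x y. x \<in> space M \<Longrightarrow> y \<in> space M \<Longrightarrow> \<bar>\<integral>z. f x y z \<partial>M\<bar> \<le> B"
    using bounded3_inner(1)[OF assms] not_empty unfolding bounded3_def by blast
  then show ?thesis unfolding integral3_def
    by (intro integral_swap[symmetric, where B = B] bounded3_inner(2) assms) auto
qed

lemma integral3_swap23:
  assumes "bounded3 f"
  shows "integral3 (\<lambda>x y z. f x z y) = integral3 f"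
proof -
  have [measurable]: "(\<lambda>(x, y, z). f x y z) \<in> borel_measurable M3"
    using assms by (simp add: bounded3_def)
  obtain B where B: "\<And>x y z. x \<in> space M \<Longrightarrow> y \<in> space M \<Longrightarrow> z \<in> space M \<Longrightarrow> \<bar>f x y z\<bar> \<le> B"
    using assms by (auto simp: bounded3_def)
  show ?thesis unfolding integral3_def
    by (intro Bochner_Integration.integral_cong refl integral_swap[symmetric, where B = B]) (use B in auto)
qed

definition triangle_density :: "('a \<Rightarrow> 'a \<Rightarrow> real) \<Rightarrow> real" where
  "triangle_density A = integral3 (\<lambda>x y z. A x y * A y z * A x z)"

text \<open>
  Paths of length two are counted by their middle vertex.
\<close>

lemma integral3_cherry:
  "integral3 (\<lambda>x y z. w x * (K x y * K x z)) = (\<integral>x. w x * (\<integral>y. K x y \<partial>M)\<^sup>2 \<partial>M)"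
  by (simp add: integral3_def power2_eq_square mult_ac)

lemmas bounded3_intros = bounded3_add bounded3_mult bounded3_diff bounded3_const

end

section \<open>Triangles and independent triples in a graphon\<close>

text \<open>
  Letting the kernel take all values in \<open>[0, 1]\<close> costs nothing in the estimates, and \<open>0\<close>/\<open>1\<close>-valued
  kernels are the comparability graphs of permutons. The bounds and the symmetry are required
  everywhere, so that no exceptional null sets have to be carried along.
\<close>

locale graphon = prob_space M for M :: "'a measure" +
  fixes A :: "'a \<Rightarrow> 'a \<Rightarrow> real"
  assumes measurable_kernel [measurable]: "(\<lambda>(x, y). A x y) \<in> borel_measurable (M \<Otimes>\<^sub>M M)"
    and kernel_sym: "A x y = A y x"
    and kernel_nonneg: "0 \<le> A x y"
    and kernel_le_1: "A x y \<le> 1"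

context graphon
begin

definition deg :: "'a \<Rightarrow> real" where
  "deg x = (\<integral>y. A x y \<partial>M)"

definition edge_density :: real where
  "edge_density = (\<integral>x. deg x \<partial>M)"

lemma integrable_kernel: "x \<in> space M \<Longrightarrow> integrable M (A x)"
  by (rule integrable_bdd[of _ 1]) (auto simp: kernel_nonneg kernel_le_1 abs_le_iff intro: order_trans[of _ 0])

lemma deg_measurable [measurable]: "deg \<in> borel_measurable M"
  unfolding deg_def by measurable

lemma deg_nonneg: "0 \<le> deg x"
  by (simp add: deg_def kernel_nonneg)

lemma deg_le_1: "deg x \<le> 1"
proof (cases "integrable M (A x)")
  case True
  then show ?thesis
    unfolding deg_def by (intro integral_le_const) (auto simp: kernel_le_1)
qed (simp add: deg_def not_integrable_integral_eq)

lemma bounded3_kernel: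
  "bounded3 (\<lambda>x y z. A x y)" "bounded3 (\<lambda>x y z. A y z)" "bounded3 (\<lambda>x y z. A x z)"
  "bounded3 (\<lambda>x y z. A y x)" "bounded3 (\<lambda>x y z. A z y)" "bounded3 (\<lambda>x y z. A z x)"
  by (rule bounded3_pair[OF measurable_kernel, of 1], simp add: kernel_nonneg kernel_le_1)+

lemma bounded3_deg: "bounded3 (\<lambda>x y z. deg x)" "bounded3 (\<lambda>x y z. deg y)" "bounded3 (\<lambda>x y z. deg z)"
  by (rule bounded3_coord[of _ 1], simp_all add: deg_nonneg deg_le_1)+

lemma graphon_complement: "graphon M (\<lambda>x y. 1 - A x y)"
proof unfold_locales
  show "(\<lambda>(x, y). 1 - A x y) \<in> borel_measurable (M \<Otimes>\<^sub>M M)"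
    using measurable_kernel unfolding split_beta' by (intro borel_measurable_diff) auto
qed (use kernel_nonneg kernel_le_1 kernel_sym in auto)

text \<open>
  Goodman's identity: in \<open>a b c + (1 - a) (1 - b) (1 - c)\<close> the cubic terms cancel, so the
  density of monochromatic triples depends only on the first two moments of the degree.
\<close>

lemma goodman_identity:
  "triangle_density A + triangle_density (\<lambda>x y. 1 - A x y)
     = 1 - 3 * edge_density + 3 * (\<integral>x. (deg x)\<^sup>2 \<partial>M)"
proof -
  note bdd = bounded3_intros bounded3_kernel
  have e: "integral3 (\<lambda>x y z. A x y) = edge_density" "integral3 (\<lambda>x y z. A y z) = edge_density"
      "integral3 (\<lambda>x y z. A x z) = edge_density"
    by (simp_all add: integral3_def edge_density_def deg_def prob_space)
  have c1: "integral3 (\<lambda>x y z. A x y * A x z) = (\<integral>x. (deg x)\<^sup>2 \<partial>M)"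
    using integral3_cherry[of "\<lambda>_. 1" A] by (simp add: deg_def)
  have c2: "integral3 (\<lambda>x y z. A x y * A y z) = (\<integral>x. (deg x)\<^sup>2 \<partial>M)"
    using integral3_swap12[of "\<lambda>x y z. A x y * A x z"] c1
    by (simp add: bdd kernel_sym[of y x for x y])
  have c3: "integral3 (\<lambda>x y z. A x z * A y z) = (\<integral>x. (deg x)\<^sup>2 \<partial>M)"
    using integral3_swap23[of "\<lambda>x y z. A x y * A y z"] c2
    by (simp add: bdd kernel_sym[of z y for z y])
  have "triangle_density A + triangle_density (\<lambda>x y. 1 - A x y)
      = integral3 (\<lambda>x y z. A x y * A y z * A x z + (1 - A x y) * (1 - A y z) * (1 - A x z))"
    unfolding triangle_density_def by (intro integral3_add[symmetric] bdd)
  also have "\<dots> = integral3 (\<lambda>x y z. (1 - (A x y + A y z + A x z)) + (A x y * A x z + A x y * A y z + A x z * A y z))"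
    by (simp add: algebra_simps)
  also have "\<dots> = (integral3 (\<lambda>x y z. 1) - (integral3 (\<lambda>x y z. A x y) + integral3 (\<lambda>x y z. A y z) + integral3 (\<lambda>x y z. A x z)))
       + (integral3 (\<lambda>x y z. A x y * A x z) + integral3 (\<lambda>x y z. A x y * A y z) + integral3 (\<lambda>x y z. A x z * A y z))"
    by (subst integral3_add integral3_diff, (intro bdd)+)+ simp
  finally show ?thesis
    using e c1 c2 c3 by (simp add: integral3_def prob_space)
qed

text \<open>
  Union bound for an arbitrary fractional vertex set \<open>w\<close>: a triangle either avoids the set or has one
  of its three vertices \<open>x\<close> in it, and the other two vertices are neighbours of \<open>x\<close>. It is used for
  the complementary kernel and the top part of the cut, where it bounds independent triples.
\<close>

lemma triangle_density_le:
  assumes [measurable]: "w \<in> borel_measurable M" and w: "\<And>x. 0 \<le> w x" "\<And>x. w x \<le> 1"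
  shows "triangle_density A \<le> (\<integral>x. 1 - w x \<partial>M) ^ 3 + 3 * (\<integral>x. w x * (deg x)\<^sup>2 \<partial>M)"
proof -
  have bw: "bounded3 (\<lambda>x y z. w x)" "bounded3 (\<lambda>x y z. w y)" "bounded3 (\<lambda>x y z. w z)"
    by (rule bounded3_coord[of _ 1], use w in simp_all)+
  note bdd = bounded3_intros bounded3_kernel bw
  let ?f = "\<lambda>x y z. w x * (A x y * A x z)"
  have "A x y * A y z * A x z \<le> (1 - w x) * (1 - w y) * (1 - w z)
      + w x * (A x y * A x z) + w y * (A y x * A y z) + w z * (A z x * A z y)" for x y z
  proof -
    \<comment> \<open>The choice of three vertices, written as a polynomial inequality on the unit cube.\<close>
    define t where "t = A x y * A y z * A x z"
    have t: "0 \<le> t" "t \<le> 1" "t \<le> A x y * A x z" "t \<le> A y x * A y z" "t \<le> A z x * A z y"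
      unfolding t_def kernel_sym[of y x] kernel_sym[of z x] kernel_sym[of z y]
      using kernel_nonneg kernel_le_1
      by (auto simp: mult.assoc mult.left_commute[of _ "A y z"] mult.commute[of "A y z"]
          intro!: mult_le_one mult_nonneg_nonneg mult_left_mono mult_left_le mult_left_le_one_le)
    have "(1 - w x - w y) * (1 - w z) \<le> (1 - w x) * (1 - w y) * (1 - w z)"
      using w by (intro mult_right_mono) (simp_all add: algebra_simps)
    moreover have "(1 - w x - w y) * (1 - w z) = 1 - w x - w y - w z + (w x * w z + w y * w z)"
      by (simp add: algebra_simps)
    moreover have "0 \<le> w x * w z + w y * w z"
      using w by simp
    ultimately have one: "1 \<le> (1 - w x) * (1 - w y) * (1 - w z) + w x + w y + w z"
      by linarith
    have "t \<le> ((1 - w x) * (1 - w y) * (1 - w z) + w x + w y + w z) * t"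
      using mult_right_mono[OF one t(1)] by simp
    also have "\<dots> = (1 - w x) * (1 - w y) * (1 - w z) * t + w x * t + w y * t + w z * t"
      by (simp add: algebra_simps)
    also have "\<dots> \<le> (1 - w x) * (1 - w y) * (1 - w z) * 1
        + w x * (A x y * A x z) + w y * (A y x * A y z) + w z * (A z x * A z y)"
      using t w by (intro add_mono mult_left_mono) auto
    finally show ?thesis
      by (simp add: t_def)
  qed
  then have "triangle_density A \<le> integral3 (\<lambda>x y z. (1 - w x) * (1 - w y) * (1 - w z)
      + w x * (A x y * A x z) + w y * (A y x * A y z) + w z * (A z x * A z y))"
    unfolding triangle_density_def by (intro integral3_mono bdd)
  also have "\<dots> = integral3 (\<lambda>x y z. (1 - w x) * (1 - w y) * (1 - w z)) + integral3 ?f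
      + integral3 (\<lambda>x y z. ?f y x z) + integral3 (\<lambda>x y z. ?f z x y)"
    by (subst integral3_add, (intro bdd)+)+ simp
  also have "integral3 (\<lambda>x y z. ?f z x y) = integral3 (\<lambda>x y z. ?f y x z)"
    by (rule integral3_swap23) (intro bdd)
  also have "integral3 (\<lambda>x y z. ?f y x z) = integral3 ?f"
    by (rule integral3_swap12) (intro bdd)
  also have "integral3 ?f = (\<integral>x. w x * (deg x)\<^sup>2 \<partial>M)"
    using integral3_cherry[of w A] by (simp add: deg_def)
  also have "integral3 (\<lambda>x y z. (1 - w x) * (1 - w y) * (1 - w z)) = (\<integral>x. 1 - w x \<partial>M) ^ 3"
    by (simp add: integral3_def power3_eq_cube mult.assoc)
  finally show ?thesis by simp
qed

end

section \<open>Cutting a graphon at a self-consistent degree\<close>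

text \<open>
  The weight \<open>w\<close> is the indicator of the top part. Because its measure equals the level \<open>\<alpha>\<close> of the
  cut, the part of a degree in excess of \<open>\<alpha>\<close> must leave the top part. Fractional weights are needed when many vertices have degree exactly \<open>\<alpha>\<close>. The number
  \<open>\<beta>\<close> is a parameter so that the complementary graphon is an instance with \<open>\<alpha>\<close> and \<open>\<beta>\<close> exchanged.
\<close>

locale graphon_cut = graphon +
  fixes w :: "'a \<Rightarrow> real" and \<alpha> \<beta> :: real
  assumes cut_measurable [measurable]: "w \<in> borel_measurable M"
    and cut_nonneg: "0 \<le> w x" and cut_le_1: "w x \<le> 1"
    and integral_cut: "(\<integral>x. w x \<partial>M) = \<alpha>"
    and cut_top: "x \<in> space M \<Longrightarrow> w x \<noteq> 0 \<Longrightarrow> \<alpha> \<le> deg x"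
    and cut_bot: "x \<in> space M \<Longrightarrow> w x \<noteq> 1 \<Longrightarrow> deg x \<le> \<alpha>"
    and beta_def: "\<beta> = 1 - \<alpha>"
begin

text \<open>
  These two numbers are the \<open>v\<close> and \<open>l\<close> of the introduction.
\<close>

definition excess :: real where
  "excess = (\<integral>x. w x * (deg x - \<alpha>) \<partial>M)"

definition low :: real where
  "low = (\<integral>x. (1 - w x) * deg x \<partial>M)"

lemma alpha_bounds: "0 \<le> \<alpha>" "\<alpha> \<le> 1"
  unfolding integral_cut[symmetric]
  by (simp add: cut_nonneg)
     (rule integral_le_const, auto intro: integrable_bdd[of _ 1] simp: cut_nonneg cut_le_1)

lemma bounded3_cut: "bounded3 (\<lambda>x y z. w x)" "bounded3 (\<lambda>x y z. w y)" "bounded3 (\<lambda>x y z. w z)"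
  by (rule bounded3_coord[of _ 1], simp_all add: cut_nonneg cut_le_1)+

lemma integrable_cut_products:
  "integrable M w" "integrable M deg" "integrable M (\<lambda>x. w x * deg x)"
  "integrable M (\<lambda>x. (deg x)\<^sup>2)" "integrable M (\<lambda>x. w x * (deg x)\<^sup>2)"
  by (rule integrable_bdd[of _ 1];
      auto simp: abs_mult cut_nonneg cut_le_1 deg_nonneg deg_le_1 power_le_one
        intro!: mult_le_one)+

lemma edge_density_cut: "edge_density = \<alpha>\<^sup>2 + excess + low"
  using integral_cut integrable_cut_products
  by (simp add: edge_density_def excess_def low_def algebra_simps power2_eq_square)

lemma sum_squares_cut:
  "(\<integral>x. (deg x)\<^sup>2 \<partial>M)
     = (\<integral>x. w x * (deg x - \<alpha>)\<^sup>2 \<partial>M) + 2 * \<alpha> * excess + \<alpha> ^ 3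
       + (\<integral>x. (1 - w x) * (deg x)\<^sup>2 \<partial>M)"
proof -
  have "(\<integral>x. w x * (deg x - \<alpha>)\<^sup>2 \<partial>M)
      = (\<integral>x. w x * (deg x)\<^sup>2 - 2 * \<alpha> * (w x * deg x) + \<alpha>\<^sup>2 * w x \<partial>M)"
    by (simp add: power2_eq_square algebra_simps)
  also have "\<dots> = (\<integral>x. w x * (deg x)\<^sup>2 \<partial>M) - 2 * \<alpha> * (\<integral>x. w x * deg x \<partial>M) + \<alpha> ^ 3"
    using integrable_cut_products integral_cut by (simp add: power2_eq_square power3_eq_cube)
  finally show ?thesis
    using integrable_cut_products integral_cut
    by (simp add: excess_def right_diff_distrib left_diff_distrib power2_eq_square power3_eq_cube)
qed

text \<open>
  A vertex has at most measure \<open>\<alpha>\<close> of neighbours in the top part, so all further degree must go to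
  the bottom part.
\<close>

lemma deg_le_bottom:
  assumes [measurable]: "x \<in> space M"
  shows "deg x - \<alpha> \<le> (\<integral>y. (1 - w y) * A x y \<partial>M)"
proof -
  have "A x \<in> borel_measurable M"
    using integrable_kernel[OF assms] by auto
  then have int: "integrable M (\<lambda>y. w y * A x y)"
    by (intro integrable_bdd[of _ 1])
       (auto simp: abs_mult cut_nonneg cut_le_1 kernel_nonneg kernel_le_1 intro!: mult_le_one)
  have "(\<integral>y. w y * A x y \<partial>M) \<le> (\<integral>y. w y \<partial>M)"
    by (intro integral_mono int integrable_cut_products)
       (simp add: mult_left_le cut_nonneg kernel_le_1)
  then show ?thesis
    using int integrable_kernel[OF assms] by (simp add: deg_def algebra_simps integral_cut)
qed

text \<open>
  Double counting of the edges between the two parts.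
\<close>

lemma excess_le_low: "excess \<le> low"
proof -
  note bdd = bounded3_intros bounded3_kernel bounded3_cut bounded3_deg
  have "excess = integral3 (\<lambda>x y z. w x * (deg x - \<alpha>))"
    by (simp add: integral3_def excess_def prob_space)
  also have "\<dots> \<le> integral3 (\<lambda>x y z. \<integral>u. w x * ((1 - w u) * A x u) \<partial>M)"
    by (intro integral3_mono bounded3_inner(1)[of "\<lambda>x y z. w x * ((1 - w z) * A x z)"] bdd)
       (simp add: cut_nonneg deg_le_bottom mult_left_mono)
  also have "\<dots> = integral3 (\<lambda>x y z. w x * ((1 - w z) * A x z))"
    by (simp add: integral3_def prob_space)
  also have "\<dots> \<le> integral3 (\<lambda>x y z. (1 - w z) * A x z)"
    by (intro integral3_mono bdd) (simp add: mult_left_le_one_le cut_nonneg cut_le_1 kernel_nonneg)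
  also have "\<dots> = integral3 (\<lambda>x y z. (1 - w y) * A x y)"
    by (rule integral3_swap23) (intro bdd)
  also have "\<dots> = integral3 (\<lambda>x y z. (1 - w x) * A y x)"
    by (rule integral3_swap12) (intro bdd)
  also have "\<dots> = low"
    by (simp add: integral3_def low_def deg_def prob_space kernel_sym[of y x for x y])
  finally show ?thesis .
qed

text \<open>
  The inequality behind \<open>sum_squares_codegree_bound\<close>. Here \<open>x\<close> and \<open>y\<close> are the degrees of two bottom
  vertices and \<open>c\<close> their common degree into the top part. With \<open>c\<close> replaced by \<open>min x y = x\<close> it becomes
  \<open>2 b x (a - y) \<le> a (x (a - x) + y (a - y))\<close>, which follows from \<open>b \<le> a\<close> and \<open>x \<le> y\<close>. Equality
  at \<open>x, y \<in> {0, a}\<close> reflects that the bound is sharp for bottom degrees in \<open>{0, a}\<close>. Stated pair by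
  pair it avoids any rearrangement of the degrees.
\<close>

lemma codegree_pair_bound:
  fixes a b c x y :: real
  assumes "0 \<le> c" "c \<le> x" "c \<le> y" "x \<le> a" "y \<le> a" "0 < a" "0 < b" "b \<le> a"
  shows "c \<le> x * y / a + (x * (a - x) + y * (a - y)) / (2 * b)"
proof -
  have *: "c \<le> x * y / a + (x * (a - x) + y * (a - y)) / (2 * b)"
    if "0 \<le> c" "c \<le> x" "x \<le> y" "x \<le> a" "y \<le> a" for x y
  proof -
    have "x * (a - y) * (2 * b) \<le> x * (a - y) * (2 * a)"
      using that assms(8) by (intro mult_left_mono) auto
    moreover have "a * (x * (a - y) + x * (a - y)) \<le> a * (x * (a - x) + y * (a - y))"
      using that \<open>0 < a\<close> by (intro mult_left_mono add_mono mult_mono) auto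
    ultimately have "x \<le> x * y / a + (x * (a - x) + y * (a - y)) / (2 * b)"
      using assms(6,7) by (simp add: field_simps)
    with that show ?thesis by simp
  qed
  show ?thesis
    using *[of x y] *[of y x] assms by (cases "x \<le> y") (simp_all add: ac_simps)
qed

lemma sum_squares_pointwise_bounds:
  "(\<integral>x. w x * (deg x - \<alpha>)\<^sup>2 \<partial>M) \<le> \<beta> * excess"
  "(\<integral>x. (1 - w x) * (deg x)\<^sup>2 \<partial>M) \<le> \<alpha> * low"
proof -
  have int: "integrable M (\<lambda>x. w x * (deg x - \<alpha>)\<^sup>2)" "integrable M (\<lambda>x. w x * (deg x - \<alpha>))"
      "integrable M (\<lambda>x. (1 - w x) * (deg x)\<^sup>2)" "integrable M (\<lambda>x. (1 - w x) * deg x)"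
  proof -
    have "integrable M (\<lambda>x. w x * (deg x)\<^sup>2 - 2 * \<alpha> * (w x * deg x) + \<alpha>\<^sup>2 * w x)"
      using integrable_cut_products by simp
    also have "(\<lambda>x. w x * (deg x)\<^sup>2 - 2 * \<alpha> * (w x * deg x) + \<alpha>\<^sup>2 * w x)
        = (\<lambda>x. w x * (deg x - \<alpha>)\<^sup>2)"
      by (auto simp: power2_eq_square algebra_simps)
    finally show "integrable M (\<lambda>x. w x * (deg x - \<alpha>)\<^sup>2)" .
  qed (use integrable_cut_products in \<open>simp_all add: algebra_simps\<close>)
  have "w x * (deg x - \<alpha>)\<^sup>2 \<le> \<beta> * (w x * (deg x - \<alpha>))" if "x \<in> space M" for x
  proof (cases "w x = 0")
    case False
    then have "(deg x - \<alpha>) * (deg x - \<alpha>) \<le> \<beta> * (deg x - \<alpha>)"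
      using cut_top[OF that] deg_le_1[of x] by (intro mult_right_mono) (auto simp: beta_def)
    from mult_left_mono[OF this cut_nonneg[of x]] show ?thesis
      by (simp add: power2_eq_square mult_ac)
  qed simp
  then have "(\<integral>x. w x * (deg x - \<alpha>)\<^sup>2 \<partial>M) \<le> (\<integral>x. \<beta> * (w x * (deg x - \<alpha>)) \<partial>M)"
    by (intro integral_mono int integrable_mult_right)
  then show "(\<integral>x. w x * (deg x - \<alpha>)\<^sup>2 \<partial>M) \<le> \<beta> * excess"
    by (simp add: excess_def)
  have "(1 - w x) * (deg x)\<^sup>2 \<le> \<alpha> * ((1 - w x) * deg x)" if "x \<in> space M" for x
  proof (cases "w x = 1")
    case False
    then have "deg x * deg x \<le> \<alpha> * deg x"
      using cut_bot[OF that] deg_nonneg[of x] by (intro mult_right_mono) auto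
    from mult_left_mono[OF this, of "1 - w x"] show ?thesis
      using cut_le_1[of x] by (simp add: power2_eq_square mult_ac)
  qed simp
  then have "(\<integral>x. (1 - w x) * (deg x)\<^sup>2 \<partial>M) \<le> (\<integral>x. \<alpha> * ((1 - w x) * deg x) \<partial>M)"
    by (intro integral_mono int integrable_mult_right)
  then show "(\<integral>x. (1 - w x) * (deg x)\<^sup>2 \<partial>M) \<le> \<alpha> * low"
    by (simp add: low_def)
qed

text \<open>
  On the top part \<open>deg - \<alpha>\<close> is at most the degree into the bottom part, whose square counts pairs of
  bottom neighbours. Exchanging the order of integration turns the integral of these squares into
  the integral of the common degree over pairs of bottom vertices, to which the pointwise
  inequality applies.
\<close>

lemma sum_squares_codegree_bound:
  assumes "\<beta> \<le> \<alpha>" "0 < \<beta>"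
  shows "(\<integral>x. w x * (deg x - \<alpha>)\<^sup>2 \<partial>M) + (\<integral>x. (1 - w x) * (deg x)\<^sup>2 \<partial>M)
     \<le> low\<^sup>2 / \<alpha> + \<alpha> * low"
proof -
  note bdd = bounded3_intros bounded3_kernel bounded3_cut bounded3_deg
  let ?f = "\<lambda>x y z. w x * (((1 - w y) * A x y) * ((1 - w z) * A x z))"
  let ?c = "\<lambda>x y. \<integral>u. w u * (A u x * A u y) \<partial>M"
  let ?B = "\<lambda>x y. deg x * deg y / \<alpha> + (deg x * (\<alpha> - deg x) + deg y * (\<alpha> - deg y)) / (2 * \<beta>)"
  have "0 < \<alpha>" using assms by simp
  have "(\<integral>x. w x * (deg x - \<alpha>)\<^sup>2 \<partial>M) \<le> (\<integral>x. w x * (\<integral>y. (1 - w y) * A x y \<partial>M)\<^sup>2 \<partial>M)"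
  proof -
    have "integral3 (\<lambda>x y z. w x * ((deg x - \<alpha>) * (deg x - \<alpha>)))
        \<le> integral3 (\<lambda>x y z. w x * ((\<integral>u. (1 - w u) * A x u \<partial>M) * (\<integral>u. (1 - w u) * A x u \<partial>M)))"
    proof (intro integral3_mono bdd bounded3_inner(1)[of "\<lambda>x y z. (1 - w z) * A x z"])
      fix x assume x: "x \<in> space M"
      show "w x * ((deg x - \<alpha>) * (deg x - \<alpha>))
          \<le> w x * ((\<integral>u. (1 - w u) * A x u \<partial>M) * (\<integral>u. (1 - w u) * A x u \<partial>M))"
      proof (cases "w x = 0")
        case False
        then show ?thesis
          using deg_le_bottom[OF x] cut_top[OF x] by (intro mult_left_mono mult_mono cut_nonneg) auto
      qed simp
    qed
    then show ?thesis
      by (simp add: integral3_def prob_space power2_eq_square)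
  qed
  also have "\<dots> = integral3 ?f"
    by (rule integral3_cherry[symmetric])
  \<comment> \<open>The top vertex moves to the innermost integral.\<close>
  also have "\<dots> = integral3 (\<lambda>x y z. ?f y x z)"
    by (rule integral3_swap12[symmetric]) (intro bdd)
  also have "\<dots> = integral3 (\<lambda>x y z. ?f z x y)"
    by (rule integral3_swap23[symmetric]) (intro bdd)
  also have "\<dots> = integral3 (\<lambda>x y z. (1 - w x) * (1 - w y) * (w z * (A z x * A z y)))"
    by (simp add: mult_ac)
  also have "\<dots> = integral3 (\<lambda>x y z. (1 - w x) * (1 - w y) * ?c x y)"
    by (simp add: integral3_def prob_space)
  also have "\<dots> \<le> integral3 (\<lambda>x y z. (1 - w x) * (1 - w y) * ?B x y)"
  proof (intro integral3_mono)
    show "bounded3 (\<lambda>x y z. (1 - w x) * (1 - w y) * ?c x y)"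
      by (intro bdd bounded3_inner(1)[of "\<lambda>x y z. w z * (A z x * A z y)"])
    show "bounded3 (\<lambda>x y z. (1 - w x) * (1 - w y) * ?B x y)"
      unfolding divide_inverse by (intro bdd)
    fix x y assume x: "x \<in> space M" and y: "y \<in> space M"
    have [measurable]: "A x \<in> borel_measurable M" "A y \<in> borel_measurable M"
      using integrable_kernel x y by blast+
    have A1: "w u * (A u x * A u y) \<le> A x u" "w u * (A u x * A u y) \<le> A y u" for u
      using kernel_nonneg kernel_le_1 cut_nonneg cut_le_1
      unfolding kernel_sym[of u] by (metis mult.left_commute mult_left_le mult_left_le_one_le mult_nonneg_nonneg order_trans)+
    have "integrable M (\<lambda>u. w u * (A x u * A y u))"
      by (rule integrable_bdd[of _ 1])
         (auto simp: abs_mult cut_nonneg cut_le_1 kernel_nonneg kernel_le_1 intro!: mult_le_one)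
    then have int: "integrable M (\<lambda>u. w u * (A u x * A u y))"
      by (simp add: kernel_sym[of u x for u] kernel_sym[of u y for u])
    have c: "?c x y \<le> deg x" "?c x y \<le> deg y" "0 \<le> ?c x y"
      using A1 integrable_kernel[OF x] integrable_kernel[OF y] int kernel_nonneg cut_nonneg
      unfolding deg_def by (auto intro!: integral_mono)
    show "(1 - w x) * (1 - w y) * ?c x y \<le> (1 - w x) * (1 - w y) * ?B x y"
    proof (cases "w x = 1 \<or> w y = 1")
      case False
      then show ?thesis
        using c cut_bot[OF x] cut_bot[OF y] assms \<open>0 < \<alpha>\<close>
        by (intro mult_left_mono codegree_pair_bound) (auto simp: cut_le_1)
    qed auto
  qed
  also have "\<dots> = integral3 (\<lambda>x y z. ((1 - w x) * deg x) * ((1 - w y) * deg y) / \<alpha>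
      + ((1 - w y) * ((1 - w x) * (deg x * (\<alpha> - deg x))) / (2 * \<beta>)
       + (1 - w x) * ((1 - w y) * (deg y * (\<alpha> - deg y))) / (2 * \<beta>)))"
    by (simp add: algebra_simps add_divide_distrib diff_divide_distrib)
  also have "\<dots> = integral3 (\<lambda>x y z. ((1 - w x) * deg x) * ((1 - w y) * deg y) / \<alpha>)
      + (integral3 (\<lambda>x y z. (1 - w y) * ((1 - w x) * (deg x * (\<alpha> - deg x))) / (2 * \<beta>))
       + integral3 (\<lambda>x y z. (1 - w x) * ((1 - w y) * (deg y * (\<alpha> - deg y))) / (2 * \<beta>)))"
    unfolding divide_inverse by (subst integral3_add, (intro bdd)+)+ simp
  also have "\<dots> = low\<^sup>2 / \<alpha> + (\<integral>x. (1 - w x) * (deg x * (\<alpha> - deg x)) \<partial>M)"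
  proof -
    have "(\<integral>x. 1 - w x \<partial>M) = \<beta>"
      using integrable_cut_products integral_cut by (simp add: beta_def prob_space)
    then show ?thesis
      using assms by (simp add: integral3_def prob_space low_def power2_eq_square)
  qed
  also have "\<dots> = low\<^sup>2 / \<alpha> + \<alpha> * low - (\<integral>x. (1 - w x) * (deg x)\<^sup>2 \<partial>M)"
    using integrable_cut_products
    by (simp add: low_def algebra_simps power2_eq_square)
  finally show ?thesis by simp
qed

end

section \<open>The numerical contradiction\<close>

lemma convex_quadratic_le:
  fixes l a b c :: real
  assumes "a \<le> l" "l \<le> b" "a * (a - c) \<le> m" "b * (b - c) \<le> m"
  shows "l * (l - c) \<le> m"
proof (cases "a = b")
  case False
  then have "a < b" using assms by simp
  have "(b - a) * (l * (l - c)) = (b - l) * (a * (a - c)) + (l - a) * (b * (b - c)) - (b - a) * (l - a) * (b - l)"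
    by algebra
  also have "\<dots> \<le> (b - l) * m + (l - a) * m - 0"
    using assms by (intro diff_mono add_mono mult_left_mono mult_nonneg_nonneg) auto
  also have "\<dots> = (b - a) * m"
    by algebra
  finally show ?thesis
    using \<open>a < b\<close> by simp
qed (use assms in auto)

text \<open>
  The pointwise bound on the squares simplifies to \<open>c + i \<le> 1 + 3 (v - \<beta> e)\<close>. If \<open>c + i > 0.556\<close>, this
  gives \<open>v \<ge> \<beta> e - 0.148\<close>, where \<open>0.148 = (1 - 0.556) / 3\<close>. Inserted into the bound on \<open>i\<close>, this
  leaves a cubic in \<open>\<beta>\<close> that increases on \<open>[0, 0.38]\<close> and whose value at \<open>0.38\<close> is below \<open>0.278\<close>.
\<close>

lemma high_cut_bound:
  fixes \<alpha> \<beta> v l e i c :: real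
  assumes b: "\<beta> = 1 - \<alpha>" and a: "31 / 50 \<le> \<alpha>" "\<alpha> \<le> 1"
    and e: "e = \<alpha>\<^sup>2 + v + l" "\<bar>e - 1 / 2\<bar> \<le> 1 / 1000"
    and i: "i \<le> \<beta> ^ 3 + 3 * \<beta> * (\<alpha> * \<beta> - v)"
    and s: "c + i \<le> 1 - 3 * e + 3 * (\<beta> * v + 2 * \<alpha> * v + \<alpha> ^ 3 + \<alpha> * l)"
  shows "c + i \<le> 556 / 1000 \<or> i \<le> 278 / 1000"
proof (rule disjCI)
  assume "\<not> i \<le> 278 / 1000"
  show "c + i \<le> 556 / 1000"
  proof (rule ccontr)
    assume "\<not> c + i \<le> 556 / 1000"
    moreover have "1 - 3 * e + 3 * (\<beta> * v + 2 * \<alpha> * v + \<alpha> ^ 3 + \<alpha> * l) = 1 + 3 * (v - \<beta> * e)"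
      unfolding b e(1) by algebra
    ultimately have v: "\<beta> * e - 148 / 1000 \<le> v"
      using s by simp
    have bb: "0 \<le> \<beta>" "\<beta> \<le> 19 / 50"
      using a b by simp_all
    have "\<alpha> = 1 - \<beta>"
      using b by simp
    have "i \<le> \<beta> ^ 3 + 3 * \<beta> * (\<alpha> * \<beta> - (\<beta> * (499 / 1000) - 148 / 1000))"
    proof -
      have "499 / 1000 \<le> e"
        using e(2) by linarith
      then have "\<beta> * (499 / 1000) \<le> \<beta> * e"
        using bb by (intro mult_left_mono) auto
      then have "3 * \<beta> * (\<alpha> * \<beta> - v) \<le> 3 * \<beta> * (\<alpha> * \<beta> - (\<beta> * (499 / 1000) - 148 / 1000))"
        using v bb by (intro mult_left_mono) auto
      with i show ?thesis by simp
    qed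
    \<comment> \<open>The cubic minus its value at \<open>19 / 50\<close>, with the linear factor split off.\<close>
    also have "\<dots> = 2760092 / 10000000
        - (19 / 50 - \<beta>) * (2 * \<beta> * (19 / 50 - \<beta>) + (72634 / 100000 - 17 / 1000 * \<beta>))"
      using b by (simp add: \<open>\<alpha> = 1 - \<beta>\<close> power2_eq_square power3_eq_cube field_simps)
    also have "\<dots> \<le> 2760092 / 10000000"
    proof -
      have "0 \<le> (19 / 50 - \<beta>) * (2 * \<beta> * (19 / 50 - \<beta>) + (72634 / 100000 - 17 / 1000 * \<beta>))"
        using bb by (intro mult_nonneg_nonneg add_nonneg_nonneg) auto
      then show ?thesis by linarith
    qed
    finally show False
      using \<open>\<not> i \<le> 278 / 1000\<close> by simp
  qed
qed

text \<open>
  If \<open>s > 0.556\<close>, the pointwise bound gives \<open>l \<le> l1\<close>, and \<open>v \<le> l\<close> gives \<open>l0 \<le> l\<close>. The codegree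
  bound is, after multiplication by \<open>\<alpha>\<close>, the statement that the convex quadratic \<open>l (l - \<alpha>\<^sup>2)\<close>
  exceeds \<open>m\<close>, so it suffices to refute it at \<open>l0\<close> and \<open>l1\<close>. There it becomes a polynomial in
  \<open>\<alpha> = 1 / 2 + t\<close>, perturbed by the small deviation \<open>x\<close> of the edge density from \<open>1 / 2\<close>.
\<close>

lemma low_cut_bound:
  fixes \<alpha> \<beta> v l e s :: real
  assumes b: "\<beta> = 1 - \<alpha>" and a: "1 / 2 \<le> \<alpha>" "\<alpha> \<le> 31 / 50"
    and v: "v \<le> l"
    and e: "e = \<alpha>\<^sup>2 + v + l" "\<bar>e - 1 / 2\<bar> \<le> 1 / 1000"
    and s1: "s \<le> 1 - 3 * e + 3 * (\<beta> * v + 2 * \<alpha> * v + \<alpha> ^ 3 + \<alpha> * l)"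
    and s2: "s \<le> 1 - 3 * e + 3 * (l\<^sup>2 / \<alpha> + \<alpha> * l + 2 * \<alpha> * v + \<alpha> ^ 3)"
  shows "s \<le> 556 / 1000"
proof (rule ccontr)
  assume s: "\<not> s \<le> 556 / 1000"
  define t where "t = \<alpha> - 1 / 2"
  define x where "x = e - 1 / 2"
  have t: "0 \<le> t" "t \<le> 12 / 100" and x: "\<bar>x\<bar> \<le> 1 / 1000" and \<alpha>: "\<alpha> = 1 / 2 + t" and ex: "e = 1 / 2 + x"
    using a e by (simp_all add: t_def x_def)
  define l0 where "l0 = (e - \<alpha>\<^sup>2) / 2"
  define l1 where "l1 = 148 / 1000 + \<alpha> * e - \<alpha>\<^sup>2"
  define m where "m = \<alpha> ^ 4 + \<alpha> * e - 2 * \<alpha>\<^sup>2 * e - 148 / 1000 * \<alpha>"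
  have x2: "x\<^sup>2 \<le> 1 / 1000000"
    using abs_le_square_iff[of x "1/1000"] x by (simp add: power2_eq_square)
  have t2: "t\<^sup>2 \<le> 12 / 100 * t" "t ^ 3 \<le> 144 / 10000 * t" "t ^ 4 \<le> 1728 / 1000000 * t"
  proof -
    show t2: "t\<^sup>2 \<le> 12 / 100 * t"
      using mult_right_mono[OF t(2,1)] by (simp add: power2_eq_square)
    show t3: "t ^ 3 \<le> 144 / 10000 * t"
      using mult_right_mono[OF t2 t(1)] t2 by (simp add: power2_eq_square power3_eq_cube)
    show "t ^ 4 \<le> 1728 / 1000000 * t"
      using mult_right_mono[OF t3 t(1)] t2 by (simp add: power2_eq_square power3_eq_cube power4_eq_xxxx)
  qed
  have xt: "x * u \<le> 1 / 1000 * B" if "\<bar>u\<bar> \<le> B" for u B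
  proof -
    have "x * u \<le> \<bar>x\<bar> * \<bar>u\<bar>"
      by (metis abs_ge_self abs_mult)
    also have "\<dots> \<le> 1 / 1000 * B"
      using x that by (intro mult_mono) auto
    finally show ?thesis .
  qed
  have "l0 \<le> l"
    using v e by (simp add: l0_def)
  have "l \<le> l1"
  proof -
    have "1 - 3 * e + 3 * (\<beta> * v + 2 * \<alpha> * v + \<alpha> ^ 3 + \<alpha> * l) = 1 + 3 * (\<alpha> * e - \<alpha>\<^sup>2 - l)"
      unfolding b e(1) by algebra
    then show ?thesis
      using s s1 by (simp add: l1_def)
  qed
  have "l0 * (l0 - \<alpha>\<^sup>2) \<le> m"
  proof -
    define q where "q = t\<^sup>2 * (1 / 4 - t)"
    have "l0 * (l0 - \<alpha>\<^sup>2) - m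
        = (23 / 1000 * t + q / 2 - t ^ 4 / 4 - 4125 / 1000000) + x * t\<^sup>2 + x\<^sup>2 / 4"
      unfolding l0_def m_def \<alpha> ex q_def
      by (simp add: power2_eq_square power3_eq_cube power4_eq_xxxx field_simps)
    \<comment> \<open>\<open>q\<close> is largest at the right end \<open>t = 12 / 100\<close>. The margin there is about \<open>0.0004\<close>, too small for
      estimating its two powers of \<open>t\<close> separately.\<close>
    moreover have "q \<le> 1872 / 1000000"
    proof -
      have "t * t \<le> 12 / 100 * t"
        using t2(1) by (simp add: power2_eq_square)
      then have "0 \<le> 156 / 10000 + 12 / 100 * t + t * (1 / 100 - t)"
        using t by (simp add: right_diff_distrib)
      then have "0 \<le> (12 / 100 - t) * (156 / 10000 + 12 / 100 * t + t * (1 / 100 - t))"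
        using t by (intro mult_nonneg_nonneg) auto
      also have "\<dots> = 1872 / 1000000 - q"
        by (simp add: q_def power2_eq_square field_simps)
      finally show ?thesis by simp
    qed
    moreover have "x * t\<^sup>2 \<le> 1 / 1000 * (144 / 10000)"
      using t t2(1) by (intro xt) simp
    moreover have "0 \<le> t ^ 4"
      by simp
    ultimately show ?thesis
      using x2 t by linarith
  qed
  moreover have "l1 * (l1 - \<alpha>\<^sup>2) \<le> m"
  proof -
    have "l1 * (l1 - \<alpha>\<^sup>2) - m = t ^ 4 + t ^ 3 / 2 + 56 / 1000 * t\<^sup>2 - 23 / 1000 * t - 3596 / 1000000
        + x * (\<alpha> * (46 / 1000 - 3 * t\<^sup>2)) + x\<^sup>2 * \<alpha>\<^sup>2"
      unfolding l1_def m_def \<alpha> ex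
      by (simp add: power2_eq_square power3_eq_cube power4_eq_xxxx field_simps)
    moreover have "x * (\<alpha> * (46 / 1000 - 3 * t\<^sup>2)) \<le> 1 / 1000 * (1 * (46 / 1000))"
      using t2(1) t a by (intro xt) (unfold abs_mult, rule mult_mono, auto)
    moreover have "x\<^sup>2 * \<alpha>\<^sup>2 \<le> 1 / 1000000 * 1"
      using x2 a by (intro mult_mono) (auto simp: power_le_one)
    ultimately show ?thesis
      using t2 t by simp
  qed
  ultimately have "l * (l - \<alpha>\<^sup>2) \<le> m"
    using \<open>l0 \<le> l\<close> \<open>l \<le> l1\<close> by (intro convex_quadratic_le[of l0 l l1])
  moreover have "s * \<alpha> \<le> (1 - 3 * e + 3 * (l\<^sup>2 / \<alpha> + \<alpha> * l + 2 * \<alpha> * v + \<alpha> ^ 3)) * \<alpha>"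
    using s2 a by (intro mult_right_mono) auto
  moreover have "(1 - 3 * e + 3 * (l\<^sup>2 / \<alpha> + \<alpha> * l + 2 * \<alpha> * v + \<alpha> ^ 3)) * \<alpha>
      = 556 / 1000 * \<alpha> + 3 * (l * (l - \<alpha>\<^sup>2) - m)"
  proof -
    have "v = e - \<alpha>\<^sup>2 - l" using e by simp
    have "l\<^sup>2 / \<alpha> * \<alpha> = l\<^sup>2" using a by simp
    then show ?thesis
      unfolding m_def \<open>v = _\<close> by algebra
  qed
  moreover have "556 / 1000 * \<alpha> < s * \<alpha>"
    using s a by (intro mult_strict_right_mono) auto
  ultimately show False by simp
qed

text \<open>
  Either alternative excludes that both densities exceed \<open>0.278\<close>. The threshold \<open>31 / 50\<close> leaves room
  on both sides: below it the sum of the densities is too small, above it there are too few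
  independent triples.
\<close>

lemma (in graphon_cut) monochromatic_or_independent_small:
  assumes "1 / 2 \<le> \<alpha>" and e: "\<bar>edge_density - 1 / 2\<bar> \<le> 1 / 1000"
  shows "triangle_density A + triangle_density (\<lambda>x y. 1 - A x y) \<le> 556 / 1000
    \<or> triangle_density (\<lambda>x y. 1 - A x y) \<le> 278 / 1000"
proof -
  interpret co: graphon M "\<lambda>x y. 1 - A x y"
    by (rule graphon_complement)
  have codeg: "co.deg x = 1 - deg x" if "x \<in> space M" for x
    using integrable_kernel[OF that] by (simp add: co.deg_def deg_def prob_space)
  have "(\<integral>x. w x * (co.deg x)\<^sup>2 \<partial>M) \<le> (\<integral>x. \<beta> * (w x * (1 - deg x)) \<partial>M)"
  proof (rule integral_mono)
    show "integrable M (\<lambda>x. w x * (co.deg x)\<^sup>2)"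
      by (rule integrable_bdd[of _ 1])
         (auto simp: abs_mult cut_nonneg cut_le_1 co.deg_nonneg co.deg_le_1 power_le_one intro!: mult_le_one)
    show "integrable M (\<lambda>x. \<beta> * (w x * (1 - deg x)))"
      using integrable_cut_products by (simp add: algebra_simps)
    show "w x * (co.deg x)\<^sup>2 \<le> \<beta> * (w x * (1 - deg x))" if x: "x \<in> space M" for x
    proof (cases "w x = 0")
      case False
      then have "(1 - deg x) * (1 - deg x) \<le> \<beta> * (1 - deg x)"
        using cut_top[OF x] deg_le_1[of x] by (intro mult_right_mono) (auto simp: beta_def)
      from mult_left_mono[OF this cut_nonneg[of x]] show ?thesis
        by (simp add: codeg[OF x] power2_eq_square mult_ac)
    qed simp
  qed
  also have "\<dots> = \<beta> * (\<alpha> * \<beta> - excess)"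
    using integrable_cut_products integral_cut by (simp add: excess_def beta_def algebra_simps)
  finally have "(\<integral>x. w x * (co.deg x)\<^sup>2 \<partial>M) \<le> \<beta> * (\<alpha> * \<beta> - excess)" .
  moreover have "(\<integral>x. 1 - w x \<partial>M) = \<beta>"
    using integrable_cut_products integral_cut by (simp add: prob_space beta_def)
  ultimately have i: "triangle_density (\<lambda>x y. 1 - A x y) \<le> \<beta> ^ 3 + 3 * \<beta> * (\<alpha> * \<beta> - excess)"
    using co.triangle_density_le[OF cut_measurable cut_nonneg cut_le_1] by (simp add: mult.assoc)
  note s = goodman_identity[unfolded sum_squares_cut]
  note b = sum_squares_pointwise_bounds
  show ?thesis
  proof (cases "31 / 50 \<le> \<alpha>")
    case True
    then show ?thesis
      using edge_density_cut e i s b alpha_bounds beta_def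
      by (intro high_cut_bound[of \<beta> \<alpha> edge_density excess low]) auto
  next
    case False
    then have "\<beta> \<le> \<alpha>" "0 < \<beta>"
      using assms beta_def by auto
    from sum_squares_codegree_bound[OF this] False show ?thesis
      using edge_density_cut e s b assms beta_def excess_le_low
      by (intro disjI1 low_cut_bound[of \<beta> \<alpha> excess low edge_density]) auto
  qed
qed

section \<open>Existence of the cut and the bound for graphons\<close>

text \<open>
  The measure of \<open>{x. a \<le> D x}\<close> decreases in \<open>a\<close> and hence crosses the diagonal at some \<open>\<alpha>\<close>. It may jump
  across it, in which case the level set of \<open>\<alpha>\<close> has positive measure and the right fraction \<open>c\<close> of
  it fills the gap.
\<close>

lemma (in prob_space) exists_fractional_cut:
  fixes D :: "'a \<Rightarrow> real"
  assumes [measurable]: "D \<in> borel_measurable M"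
  obtains w \<alpha> where "w \<in> borel_measurable M" "\<And>x. 0 \<le> w x" "\<And>x. w x \<le> 1" "(\<integral>x. w x \<partial>M) = \<alpha>"
    "\<And>x. w x \<noteq> 0 \<Longrightarrow> \<alpha> \<le> D x" "\<And>x. w x \<noteq> 1 \<Longrightarrow> D x \<le> \<alpha>"
proof -
  define F where "F a = prob {x \<in> space M. a \<le> D x}" for a
  define K where "K = {a. 0 \<le> a \<and> a \<le> 1 \<and> a \<le> F a}"
  define \<alpha> where "\<alpha> = Sup K"
  have F_anti: "F b \<le> F a" if "a \<le> b" for a b
    unfolding F_def using that by (intro finite_measure_mono) auto
  have K: "0 \<in> K" "bdd_above K"
    by (auto simp: K_def F_def intro!: bdd_aboveI[of _ 1])
  have \<alpha>01: "0 \<le> \<alpha>" "\<alpha> \<le> 1"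
    unfolding \<alpha>_def using K by (auto intro!: cSup_upper cSup_least simp: K_def)
  have below: "a \<le> F a" if a: "a < \<alpha>" for a
  proof -
    have "K \<noteq> {}"
      using K(1) by blast
    then obtain a' where "a' \<in> K" "a < a'"
      using a less_cSup_iff[OF _ K(2), of a] unfolding \<alpha>_def by blast
    then show ?thesis
      using F_anti[of a a'] by (auto simp: K_def)
  qed
  have above: "F a \<le> a" if "\<alpha> < a" for a
  proof (cases "a \<le> 1")
    case True
    have "a \<notin> K"
      using that cSup_upper[OF _ K(2), of a] by (auto simp: \<alpha>_def)
    then show ?thesis
      using True \<alpha>01 that by (auto simp: K_def)
  qed (use F_def in \<open>auto intro: order_trans[OF prob_le_1]\<close>)
  have lim: "(\<lambda>n. \<alpha> - 1 / real (Suc n)) \<longlonglongrightarrow> \<alpha>" "(\<lambda>n. \<alpha> + 1 / real (Suc n)) \<longlonglongrightarrow> \<alpha>"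
    using tendsto_diff[OF tendsto_const LIMSEQ_inverse_real_of_nat, of \<alpha>]
      tendsto_add[OF tendsto_const LIMSEQ_inverse_real_of_nat, of \<alpha>]
    by (simp_all add: inverse_eq_divide)
  have ge: "\<alpha> \<le> prob {x \<in> space M. \<alpha> \<le> D x}"
  proof -
    have "(\<lambda>n. F (\<alpha> - 1 / real (Suc n))) \<longlonglongrightarrow> prob (\<Inter>n. {x \<in> space M. \<alpha> - 1 / real (Suc n) \<le> D x})"
      unfolding F_def
      by (rule finite_Lim_measure_decseq) (auto simp: decseq_def frac_le intro: order_trans[rotated])
    also have "(\<Inter>n. {x \<in> space M. \<alpha> - 1 / real (Suc n) \<le> D x}) = {x \<in> space M. \<alpha> \<le> D x}"
    proof (intro equalityI subsetI)
      fix x assume x: "x \<in> (\<Inter>n. {x \<in> space M. \<alpha> - 1 / real (Suc n) \<le> D x})"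
      then have "\<alpha> \<le> D x"
        by (intro LIMSEQ_le_const2[OF lim(1)]) auto
      with x show "x \<in> {x \<in> space M. \<alpha> \<le> D x}" by auto
    qed (auto intro: order_trans[rotated])
    finally show ?thesis
      by (rule LIMSEQ_le[OF lim(1)]) (auto intro!: below)
  qed
  have gt: "prob {x \<in> space M. \<alpha> < D x} \<le> \<alpha>"
  proof -
    have "(\<lambda>n. F (\<alpha> + 1 / real (Suc n))) \<longlonglongrightarrow> prob (\<Union>n. {x \<in> space M. \<alpha> + 1 / real (Suc n) \<le> D x})"
      unfolding F_def
      by (rule finite_Lim_measure_incseq) (auto simp: incseq_def frac_le intro: order_trans[rotated])
    also have "(\<Union>n. {x \<in> space M. \<alpha> + 1 / real (Suc n) \<le> D x}) = {x \<in> space M. \<alpha> < D x}"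
    proof (intro equalityI subsetI)
      fix x assume x: "x \<in> {x \<in> space M. \<alpha> < D x}"
      then obtain n where "1 / real (Suc n) < D x - \<alpha>"
        using reals_Archimedean[of "D x - \<alpha>"] by (auto simp: inverse_eq_divide)
      with x show "x \<in> (\<Union>n. {x \<in> space M. \<alpha> + 1 / real (Suc n) \<le> D x})"
        by (auto intro!: exI[of _ n])
    qed (auto intro: less_le_trans[rotated])
    finally show ?thesis
      by (rule LIMSEQ_le[OF _ lim(2)]) (auto intro!: above)
  qed
  let ?E = "{x \<in> space M. D x = \<alpha>}" and ?G = "{x \<in> space M. \<alpha> < D x}"
  have eq: "prob {x \<in> space M. \<alpha> \<le> D x} = prob ?G + prob ?E"
    by (subst finite_measure_Union[symmetric]) (auto intro!: arg_cong[of _ _ prob])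
  define c where "c = (if prob ?E = 0 then 0 else (\<alpha> - prob ?G) / prob ?E)"
  have c: "0 \<le> c" "c \<le> 1" "prob ?G + c * prob ?E = \<alpha>"
    using ge gt eq measure_nonneg[of M ?E] by (auto simp: c_def divide_le_eq)
  define w where "w x = (if \<alpha> < D x then 1 else if D x = \<alpha> then c else 0)" for x
  show ?thesis
  proof (rule that[of w \<alpha>])
    show "w \<in> borel_measurable M"
      unfolding w_def by measurable
    have "integrable M (indicator ?G :: _ \<Rightarrow> real)" "integrable M (indicator ?E :: _ \<Rightarrow> real)"
      by (rule integrable_bdd[of _ 1]; simp)+
    note int = this
    have "(\<integral>x. w x \<partial>M) = (\<integral>x. indicator ?G x + c * indicator ?E x \<partial>M)"
      by (intro Bochner_Integration.integral_cong) (auto simp: w_def indicator_def)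
    also have "\<dots> = \<alpha>"
      using c int by simp
    finally show "(\<integral>x. w x \<partial>M) = \<alpha>" .
  qed (use c in \<open>auto simp: w_def split: if_splits\<close>)
qed

text \<open>
  Complementation exchanges triangles with independent triples and a cut at \<open>\<alpha>\<close> with one at
  \<open>1 - \<alpha>\<close>, while the hypothesis on the edge density is symmetric. So the case \<open>\<alpha> < 1 / 2\<close> reduces to
  the one already treated.
\<close>

lemma (in graphon) clique_or_independent_density_small:
  assumes e: "\<bar>edge_density - 1 / 2\<bar> \<le> 1 / 1000"
  shows "triangle_density A \<le> 278 / 1000 \<or> triangle_density (\<lambda>x y. 1 - A x y) \<le> 278 / 1000"
proof -
  obtain w \<alpha> where [measurable]: "w \<in> borel_measurable M"
    and w: "\<And>x. 0 \<le> w x" "\<And>x. w x \<le> 1" "(\<integral>x. w x \<partial>M) = \<alpha>"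
    "\<And>x. w x \<noteq> 0 \<Longrightarrow> \<alpha> \<le> deg x" "\<And>x. w x \<noteq> 1 \<Longrightarrow> deg x \<le> \<alpha>"
    using exists_fractional_cut[of deg] by auto
  show ?thesis
  proof (cases "1 / 2 \<le> \<alpha>")
    case True
    interpret graphon_cut M A w \<alpha> "1 - \<alpha>"
      by unfold_locales (use w in auto)
    from monochromatic_or_independent_small[OF True e] show ?thesis
      by auto
  next
    case False
    interpret co: graphon M "\<lambda>x y. 1 - A x y"
      by (rule graphon_complement)
    have codeg: "co.deg x = 1 - deg x" if "x \<in> space M" for x
      using integrable_kernel[OF that] by (simp add: co.deg_def deg_def prob_space)
    have int: "integrable M w" "integrable M deg"
      by (rule integrable_bdd[of _ 1]; simp add: w deg_nonneg deg_le_1)+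
    interpret graphon_cut M "\<lambda>x y. 1 - A x y" "\<lambda>x. 1 - w x" "1 - \<alpha>" \<alpha>
      by unfold_locales (use w codeg int in \<open>auto simp: prob_space\<close>)
    have "co.edge_density = 1 - edge_density"
    proof -
      have "co.edge_density = (\<integral>x. 1 - deg x \<partial>M)"
        unfolding co.edge_density_def by (intro Bochner_Integration.integral_cong) (auto simp: codeg)
      then show ?thesis
        using int by (simp add: edge_density_def prob_space)
    qed
    then show ?thesis
      using monochromatic_or_independent_small False e by (auto simp: abs_minus_commute)
  qed
qed

section \<open>Pattern densities as densities of the comparability graph\<close>

definition concordant :: "real \<times> real \<Rightarrow> real \<times> real \<Rightarrow> bool" where
  "concordant p q \<longleftrightarrow> fst p < fst q \<and> snd p < snd q \<or> fst q < fst p \<and> snd q < snd p"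

definition discordant :: "real \<times> real \<Rightarrow> real \<times> real \<Rightarrow> bool" where
  "discordant p q \<longleftrightarrow> fst p < fst q \<and> snd q < snd p \<or> fst q < fst p \<and> snd p < snd q"

lemma exists_sorting_permutation:
  fixes f :: "nat \<Rightarrow> 'a :: linorder"
  assumes "inj_on f {..<n}"
  obtains \<sigma> where "\<sigma> permutes {..<n}" "\<And>i j. i < j \<Longrightarrow> j < n \<Longrightarrow> f (\<sigma> i) < f (\<sigma> j)"
proof -
  define xs where "xs = sorted_list_of_set (f ` {..<n})"
  have len: "length xs = n" and set: "set xs = f ` {..<n}" and sorted: "sorted_wrt (<) xs"
    using assms by (simp_all add: xs_def card_image)
  have bij: "bij_betw ((!) xs) {..<n} (f ` {..<n})"
  proof (rule bij_betw_nth)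
    show "distinct xs" by (simp add: xs_def)
  qed (simp_all only: len set)
  define \<sigma> where "\<sigma> i = (if i \<in> {..<n} then inv_into {..<n} f (xs ! i) else i)" for i
  have "bij_betw (inv_into {..<n} f \<circ> (!) xs) {..<n} {..<n}"
    using bij_betw_trans[OF bij bij_betw_inv_into[OF bij_betw_imageI[OF assms refl]]] .
  then have "bij_betw \<sigma> {..<n} {..<n}"
    by (subst bij_betw_cong[of _ _ "inv_into {..<n} f \<circ> (!) xs"]) (auto simp: \<sigma>_def)
  then have "\<sigma> permutes {..<n}"
    by (rule bij_imp_permutes) (simp add: \<sigma>_def)
  moreover have "f (\<sigma> i) = xs ! i" if "i < n" for i
    using that bij by (auto simp: \<sigma>_def bij_betw_def intro!: f_inv_into_f)
  ultimately show ?thesis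
    using sorted len by (intro that[of \<sigma>]) (auto simp: sorted_wrt_iff_nth_less)
qed

text \<open>
  For a monotone pattern the order in which the points are listed is immaterial, so the condition on
  the sorted sample can be checked on unordered pairs. The relations \<open>R\<close> and \<open>S\<close> treat
  increasing and decreasing patterns together.
\<close>

lemma induces_monotone_iff:
  fixes R :: "nat \<Rightarrow> nat \<Rightarrow> bool" and S :: "real \<Rightarrow> real \<Rightarrow> bool"
  assumes R: "sorted_wrt R \<tau>" and RS: "R = (<) \<and> S = (<) \<or> R = (>) \<and> S = (>)"
  shows "induces p \<tau> \<longleftrightarrow> (\<forall>i<length \<tau>. \<forall>j<length \<tau>. i \<noteq> j \<longrightarrow>
           fst (p i) < fst (p j) \<and> S (snd (p i)) (snd (p j)) \<or>
           fst (p j) < fst (p i) \<and> S (snd (p j)) (snd (p i)))" (is "_ \<longleftrightarrow> ?pairs")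
proof
  let ?n = "length \<tau>"
  assume "induces p \<tau>"
  then obtain \<sigma> where \<sigma>: "\<sigma> permutes {..<?n}"
    and x: "\<And>i j. i < ?n \<Longrightarrow> j < ?n \<Longrightarrow> i < j \<Longrightarrow> fst (p (\<sigma> i)) < fst (p (\<sigma> j))"
    and y: "\<And>i j. i < ?n \<Longrightarrow> j < ?n \<Longrightarrow> snd (p (\<sigma> i)) < snd (p (\<sigma> j)) \<longleftrightarrow> \<tau> ! i < \<tau> ! j"
    unfolding induces_def by blast
  have S: "S (snd (p (\<sigma> i))) (snd (p (\<sigma> j)))" if "i < j" "j < ?n" for i j
  proof -
    have "R (\<tau> ! i) (\<tau> ! j)"
      using R that by (simp add: sorted_wrt_iff_nth_less)
    with RS y[of i j] y[of j i] that show ?thesis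
      by auto
  qed
  show ?pairs
  proof (intro allI impI)
    fix i j assume ij: "i < ?n" "j < ?n" "i \<noteq> j"
    have "i \<in> \<sigma> ` {..<?n}" "j \<in> \<sigma> ` {..<?n}"
      using ij permutes_image[OF \<sigma>] by auto
    then obtain i' j' where i'j': "i = \<sigma> i'" "j = \<sigma> j'" "i' < ?n" "j' < ?n"
      by blast
    with ij consider "i' < j'" | "j' < i'"
      by (metis linorder_neqE_nat)
    then show "fst (p i) < fst (p j) \<and> S (snd (p i)) (snd (p j)) \<or>
           fst (p j) < fst (p i) \<and> S (snd (p j)) (snd (p i))"
      using x[of i' j'] x[of j' i'] S[of i' j'] S[of j' i'] i'j' by cases auto
  qed
next
  let ?n = "length \<tau>"
  assume pairs: ?pairs
  have "inj_on (\<lambda>i. fst (p i)) {..<?n}"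
  proof (intro inj_onI)
    fix i j assume "i \<in> {..<?n}" "j \<in> {..<?n}" "fst (p i) = fst (p j)"
    with pairs[rule_format, of i j] show "i = j" by auto
  qed
  then obtain \<sigma> where \<sigma>: "\<sigma> permutes {..<?n}"
    and x: "\<And>i j. i < j \<Longrightarrow> j < ?n \<Longrightarrow> fst (p (\<sigma> i)) < fst (p (\<sigma> j))"
    by (rule exists_sorting_permutation) (rule that)
  have S: "S (snd (p (\<sigma> i))) (snd (p (\<sigma> j)))" if "i < j" "j < ?n" for i j
  proof -
    have "\<sigma> i < ?n" "\<sigma> j < ?n" "\<sigma> i \<noteq> \<sigma> j"
      using that permutes_in_image[OF \<sigma>] permutes_inj[OF \<sigma>] by (auto dest: injD)
    with pairs[rule_format, of "\<sigma> i" "\<sigma> j"] x[OF that] show ?thesis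
      by auto
  qed
  have "snd (p (\<sigma> i)) < snd (p (\<sigma> j)) \<longleftrightarrow> \<tau> ! i < \<tau> ! j" if "i < ?n" "j < ?n" for i j
  proof -
    have "i < j \<Longrightarrow> R (\<tau> ! i) (\<tau> ! j)" "j < i \<Longrightarrow> R (\<tau> ! j) (\<tau> ! i)"
      using R that by (simp_all add: sorted_wrt_iff_nth_less)
    with RS S[of i j] S[of j i] that show ?thesis
      by (metis less_asym less_irrefl linorder_neqE_nat)
  qed
  with \<sigma> x show "induces p \<tau>"
    unfolding induces_def by blast
qed

lemma all_less_3: "(\<forall>i<3::nat. P i) \<longleftrightarrow> P 0 \<and> P 1 \<and> P 2"
proof -
  have "i < 3 \<longleftrightarrow> i = 0 \<or> i = 1 \<or> i = 2" for i :: nat by arith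
  then show ?thesis by metis
qed

lemma all_less_2: "(\<forall>i<2::nat. P i) \<longleftrightarrow> P 0 \<and> P 1"
proof -
  have "i < 2 \<longleftrightarrow> i = 0 \<or> i = 1" for i :: nat by arith
  then show ?thesis by metis
qed

lemma induces_12: "induces p [1, 2] \<longleftrightarrow> concordant (p 0) (p 1)"
proof -
  have len: "length [1, 2::nat] = 2" by simp
  show ?thesis
    by (subst induces_monotone_iff[of "(<)" _ "(<)"])
       (simp, simp, unfold len all_less_2 concordant_def, simp, blast)
qed

lemma induces_123:
  "induces p [1, 2, 3] \<longleftrightarrow> concordant (p 0) (p 1) \<and> concordant (p 1) (p 2) \<and> concordant (p 0) (p 2)"
proof -
  have len: "length [1, 2, 3::nat] = 3" by simp
  show ?thesis
    by (subst induces_monotone_iff[of "(<)" _ "(<)"])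
       (simp, simp, unfold len all_less_3 concordant_def, simp, blast)
qed

lemma induces_321:
  "induces p [3, 2, 1] \<longleftrightarrow> discordant (p 0) (p 1) \<and> discordant (p 1) (p 2) \<and> discordant (p 0) (p 2)"
proof -
  have len: "length [3, 2, 1::nat] = 3" by simp
  show ?thesis
    by (subst induces_monotone_iff[of "(>)" _ "(>)"])
       (simp, simp, unfold len all_less_3 discordant_def, simp, blast)
qed

context prob_space
begin

lemma integrable_PiM:
  assumes "bounded3 f" and "i \<in> I" "j \<in> I" "k \<in> I"
  shows "integrable (Pi\<^sub>M I (\<lambda>_::nat. M)) (\<lambda>p. f (p i) (p j) (p k))"
proof -
  obtain B where B: "\<And>x y z. x \<in> space M \<Longrightarrow> y \<in> space M \<Longrightarrow> z \<in> space M \<Longrightarrow> \<bar>f x y z\<bar> \<le> B"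
    using assms(1) unfolding bounded3_def by blast
  interpret P: prob_space "Pi\<^sub>M I (\<lambda>_::nat. M)"
    by (rule prob_space_PiM) (rule prob_space_axioms)
  have "(\<lambda>p. (p i, p j, p k)) \<in> Pi\<^sub>M I (\<lambda>_. M) \<rightarrow>\<^sub>M M3"
    using assms by (intro measurable_Pair measurable_component_singleton)
  from measurable_compose[OF this bounded3_measurable[OF assms(1)]] assms
  show ?thesis
    by (intro P.integrable_bdd[of _ B]) (auto simp: space_PiM PiE_iff intro!: B)
qed

lemma integral_PiM_2:
  assumes "bounded3 (\<lambda>x y z. f x y)" and [measurable]: "(\<lambda>(x, y). f x y) \<in> borel_measurable (M \<Otimes>\<^sub>M M)"
  shows "(\<integral>p. f (p 0) (p 1) \<partial>(Pi\<^sub>M {..<2::nat} (\<lambda>_. M))) = (\<integral>x. \<integral>y. f x y \<partial>M \<partial>M)"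
proof -
  interpret PP: product_prob_space "\<lambda>_::nat. M" UNIV ..
  have set2: "{..<2::nat} = insert 1 {0}" by auto
  have "(\<integral>p. f (p 0) (p 1) \<partial>(Pi\<^sub>M {..<2::nat} (\<lambda>_. M)))
      = (\<integral>p. (\<integral>y. f (p 0) y \<partial>M) \<partial>(Pi\<^sub>M {0::nat} (\<lambda>_. M)))"
    unfolding set2
    by (subst PP.product_integral_insert) (use integrable_PiM[OF assms(1), of 0 "insert 1 {0}" 1 1] in auto)
  also have "\<dots> = (\<integral>x. \<integral>y. f x y \<partial>M \<partial>M)"
    by (rule PP.product_integral_singleton) simp
  finally show ?thesis .
qed

lemma integral_PiM_3:
  assumes "bounded3 f"
  shows "(\<integral>p. f (p 0) (p 1) (p 2) \<partial>(Pi\<^sub>M {..<3::nat} (\<lambda>_. M))) = integral3 f"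
proof -
  interpret PP: product_prob_space "\<lambda>_::nat. M" UNIV ..
  have set3: "{..<3::nat} = insert 2 {..<2}" by auto
  have "(\<integral>p. f (p 0) (p 1) (p 2) \<partial>(Pi\<^sub>M {..<3::nat} (\<lambda>_. M)))
      = (\<integral>p. (\<integral>z. f (p 0) (p 1) z \<partial>M) \<partial>(Pi\<^sub>M {..<2::nat} (\<lambda>_. M)))"
    unfolding set3
    by (subst PP.product_integral_insert) (use integrable_PiM[OF assms, of 0 "insert 2 {..<2}" 1 2] in auto)
  also have "\<dots> = integral3 f"
    unfolding integral3_def by (intro integral_PiM_2 bounded3_inner assms)
  finally show ?thesis .
qed


end

lemma of_bool_pair_measurable:
  assumes "Measurable.pred (M \<Otimes>\<^sub>M N) (\<lambda>(p, q). R p q)"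
  shows "(\<lambda>(p, q). of_bool (R p q) :: real) \<in> borel_measurable (M \<Otimes>\<^sub>M N)"
  using assms by (simp add: of_bool_def split_beta')

text \<open>
  The locale makes the graphon of a permuton available, with concordance as adjacency.
\<close>

locale permuton_space =
  fixes \<gamma> :: "(real \<times> real) measure"
  assumes permuton: "permuton \<gamma>"
begin

sublocale prob_space \<gamma>
  using permuton by (simp add: permuton_def)

lemma sets_permuton: "sets \<gamma> = sets (restrict_space borel ({0..1} \<times> {0..1}))"
  using permuton by (simp add: permuton_def)

lemma coord_measurable [measurable]: "fst \<in> borel_measurable \<gamma>" "snd \<in> borel_measurable \<gamma>"
  by (auto simp: measurable_cong_sets[OF sets_permuton refl] borel_prod[symmetric]
      intro!: measurable_restrict_space1)

lemma concordant_measurable [measurable]: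
  "Measurable.pred (\<gamma> \<Otimes>\<^sub>M \<gamma>) (\<lambda>(p, q). concordant p q)"
  "Measurable.pred (\<gamma> \<Otimes>\<^sub>M \<gamma>) (\<lambda>(p, q). discordant p q)"
  unfolding concordant_def discordant_def by measurable

sublocale graphon \<gamma> "\<lambda>p q. of_bool (concordant p q)"
proof unfold_locales
  show "(\<lambda>(p, q). of_bool (concordant p q) :: real) \<in> borel_measurable (\<gamma> \<Otimes>\<^sub>M \<gamma>)"
    by (intro of_bool_pair_measurable concordant_measurable)
qed (auto simp: concordant_def)

lemma AE_coord_neq: "AE q in \<gamma>. fst q \<noteq> a" "AE q in \<gamma>. snd q \<noteq> a"
proof -
  have U: "AE x in uniform_measure lborel {0..1::real}. x \<noteq> a"
    by (rule AE_uniform_measureI) (use AE_lborel_singleton[of a] in auto)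
  have "AE x in distr \<gamma> borel fst. x \<noteq> a" "AE x in distr \<gamma> borel snd. x \<noteq> a"
    using permuton[unfolded permuton_def] U by metis+
  then show "AE q in \<gamma>. fst q \<noteq> a" "AE q in \<gamma>. snd q \<noteq> a"
    by (auto dest!: AE_distrD[rotated])
qed

lemma pattern_density_12: "pattern_density [1, 2] \<gamma> = edge_density"
proof -
  let ?M = "Pi\<^sub>M {..<2::nat} (\<lambda>_. \<gamma>)"
  interpret P: prob_space ?M
    by (rule prob_space_PiM) (rule prob_space_axioms)
  have "pattern_density [1, 2] \<gamma> = measure ?M {p \<in> space ?M. induces p [1, 2]}"
    by (simp add: pattern_density_def Let_def numeral_2_eq_2)
  also have "\<dots> = (\<integral>p. indicator {p \<in> space ?M. induces p [1, 2]} p \<partial>?M)"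
    using sets_induces[OF permuton, of "[1, 2]"] by (simp add: numeral_2_eq_2)
  also have "\<dots> = (\<integral>p. of_bool (concordant (p 0) (p 1)) \<partial>?M)"
    by (intro Bochner_Integration.integral_cong) (auto simp only: induces_12 indicator_def of_bool_def mem_Collect_eq split: if_splits)
  also have "\<dots> = edge_density"
    unfolding edge_density_def deg_def by (rule integral_PiM_2) (rule bounded3_kernel, rule measurable_kernel)
  finally show ?thesis .
qed

lemma pattern_density_3:
  assumes "length \<tau> = 3" and [measurable]: "Measurable.pred (\<gamma> \<Otimes>\<^sub>M \<gamma>) (\<lambda>(p, q). R p q)"
    and R: "\<And>p. induces p \<tau> \<longleftrightarrow> R (p 0) (p 1) \<and> R (p 1) (p 2) \<and> R (p 0) (p 2)"
  shows "pattern_density \<tau> \<gamma> = triangle_density (\<lambda>p q. of_bool (R p q))"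
proof -
  let ?M = "Pi\<^sub>M {..<3::nat} (\<lambda>_. \<gamma>)"
  have m: "(\<lambda>(p, q). of_bool (R p q) :: real) \<in> borel_measurable (\<gamma> \<Otimes>\<^sub>M \<gamma>)"
    by (rule of_bool_pair_measurable) measurable
  interpret P: prob_space ?M
    by (rule prob_space_PiM) (rule prob_space_axioms)
  have "pattern_density \<tau> \<gamma> = measure ?M {p \<in> space ?M. induces p \<tau>}"
    using assms(1) by (simp add: pattern_density_def Let_def)
  also have "\<dots> = (\<integral>p. indicator {p \<in> space ?M. induces p \<tau>} p \<partial>?M)"
    using sets_induces[OF permuton, of \<tau>] assms(1) by simp
  also have "\<dots> = (\<integral>p. of_bool (R (p 0) (p 1)) * of_bool (R (p 1) (p 2)) * of_bool (R (p 0) (p 2)) \<partial>?M)"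
    by (intro Bochner_Integration.integral_cong) (auto simp: R indicator_def)
  also have "\<dots> = triangle_density (\<lambda>p q. of_bool (R p q))"
    unfolding triangle_density_def
    by (intro integral_PiM_3[of "\<lambda>x y z. of_bool (R x y) * of_bool (R y z) * of_bool (R x z)"]
        bounded3_mult bounded3_pair[of _ 1] m) auto
  finally show ?thesis .
qed

text \<open>
  Needed because discordance is the complement of concordance only up to ties, and because the
  kernel of an explicit permuton is simple only on its support.
\<close>

lemma triangle_density_cong_AE:
  assumes [measurable]: "(\<lambda>(x, y). K x y) \<in> borel_measurable (\<gamma> \<Otimes>\<^sub>M \<gamma>)" "(\<lambda>(x, y). L x y) \<in> borel_measurable (\<gamma> \<Otimes>\<^sub>M \<gamma>)"
    and KL: "AE x in \<gamma>. AE y in \<gamma>. K x y = L x y"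
    and b: "\<And>x y. \<bar>K x y\<bar> \<le> 1" "\<And>x y. \<bar>L x y\<bar> \<le> 1"
  shows "triangle_density K = triangle_density L"
proof -
  have bdd: "bounded3 (\<lambda>x y z. K x y * K y z * K x z)" "bounded3 (\<lambda>x y z. L x y * L y z * L x z)"
    by (intro bounded3_mult bounded3_pair[of _ 1] assms)+
  have eq: "(\<integral>z. K x y * K y z * K x z \<partial>\<gamma>) = (\<integral>z. L x y * L y z * L x z \<partial>\<gamma>)"
    if [measurable]: "x \<in> space \<gamma>" "y \<in> space \<gamma>" and xy: "K x y = L x y"
      and x: "AE z in \<gamma>. K x z = L x z" and y: "AE z in \<gamma>. K y z = L y z" for x y
  proof (rule integral_cong_AE)
    show "AE z in \<gamma>. K x y * K y z * K x z = L x y * L y z * L x z"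
      using x y by eventually_elim (simp add: xy)
  qed measurable
  have eq2: "(\<integral>y. \<integral>z. K x y * K y z * K x z \<partial>\<gamma> \<partial>\<gamma>) = (\<integral>y. \<integral>z. L x y * L y z * L x z \<partial>\<gamma> \<partial>\<gamma>)"
    if x: "x \<in> space \<gamma>" and xz: "AE z in \<gamma>. K x z = L x z" for x
  proof (rule integral_cong_AE)
    show "(\<lambda>y. \<integral>z. K x y * K y z * K x z \<partial>\<gamma>) \<in> borel_measurable \<gamma>"
      using measurable_Pair2[OF bounded3_inner(2)[OF bdd(1)] x] by simp
    show "(\<lambda>y. \<integral>z. L x y * L y z * L x z \<partial>\<gamma>) \<in> borel_measurable \<gamma>"
      using measurable_Pair2[OF bounded3_inner(2)[OF bdd(2)] x] by simp
    show "AE y in \<gamma>. (\<integral>z. K x y * K y z * K x z \<partial>\<gamma>) = (\<integral>z. L x y * L y z * L x z \<partial>\<gamma>)"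
      using xz KL AE_space by eventually_elim (rule eq[OF x _ _ xz])
  qed
  have *: "(\<lambda>x. \<integral>y. \<integral>z. f x y z \<partial>\<gamma> \<partial>\<gamma>) \<in> borel_measurable \<gamma>" if "bounded3 f" for f
    using bounded3_inner(2)[OF that] by (simp add: borel_measurable_lebesgue_integral)
  show ?thesis
    unfolding triangle_density_def integral3_def
  proof (rule integral_cong_AE)
    show "AE x in \<gamma>. (\<integral>y. \<integral>z. K x y * K y z * K x z \<partial>\<gamma> \<partial>\<gamma>) = (\<integral>y. \<integral>z. L x y * L y z * L x z \<partial>\<gamma> \<partial>\<gamma>)"
      using KL AE_space by eventually_elim (rule eq2)
  qed (intro * bdd)+
qed

lemma pattern_density_123: "pattern_density [1, 2, 3] \<gamma> = triangle_density (\<lambda>p q. of_bool (concordant p q))"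
  by (rule pattern_density_3) (simp_all only: induces_123 concordant_measurable, simp)

lemma pattern_density_321: "pattern_density [3, 2, 1] \<gamma> = triangle_density (\<lambda>p q. 1 - of_bool (concordant p q))"
proof -
  have "pattern_density [3, 2, 1] \<gamma> = triangle_density (\<lambda>p q. of_bool (discordant p q))"
    by (rule pattern_density_3) (simp_all only: induces_321 concordant_measurable, simp)
  also have "\<dots> = triangle_density (\<lambda>p q. 1 - of_bool (concordant p q))"
  proof (rule triangle_density_cong_AE)
    show "(\<lambda>(p, q). of_bool (discordant p q) :: real) \<in> borel_measurable (\<gamma> \<Otimes>\<^sub>M \<gamma>)"
      by (intro of_bool_pair_measurable concordant_measurable)
    show "(\<lambda>(p, q). 1 - of_bool (concordant p q) :: real) \<in> borel_measurable (\<gamma> \<Otimes>\<^sub>M \<gamma>)"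
      using graphon_complement by (simp add: graphon_def graphon_axioms_def)
    show "AE p in \<gamma>. AE q in \<gamma>. of_bool (discordant p q) = 1 - (of_bool (concordant p q) :: real)"
    proof (rule AE_I2)
      fix p
      show "AE q in \<gamma>. of_bool (discordant p q) = 1 - (of_bool (concordant p q) :: real)"
        using AE_coord_neq(1)[of "fst p"] AE_coord_neq(2)[of "snd p"]
        by eventually_elim (auto simp: concordant_def discordant_def)
    qed
  qed auto
  finally show ?thesis .
qed

end

section \<open>The permuton with a decreasing and an increasing block\<close>

text \<open>
  The flip is restricted to the open interval \<open>(0, s)\<close>, which it maps onto itself; this makes
  preservation of Lebesgue measure an exact statement about preimages, with no boundary points to
  discard.
\<close>

definition flip_below :: "real \<Rightarrow> real \<Rightarrow> real" where
  "flip_below s x = (if 0 < x \<and> x < s then s - x else x)"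

definition block_permuton :: "real \<Rightarrow> (real \<times> real) measure" where
  "block_permuton s = distr (restrict_space lborel {0..1}) (restrict_space borel ({0..1} \<times> {0..1}))
     (\<lambda>x. (x, flip_below s x))"

lemma flip_below_measurable [measurable]: "flip_below s \<in> borel_measurable borel"
  unfolding flip_below_def by measurable

lemma emeasure_lborel_reflect:
  fixes s :: real
  assumes [measurable]: "B \<in> sets borel"
  shows "emeasure lborel {x. s - x \<in> B} = emeasure lborel B"
proof -
  have "lborel = distr lborel borel (\<lambda>x. s - x)"
    using lborel_real_affine[of "-1" s] by (simp add: density_1 one_ennreal_def[symmetric])
  then have "emeasure lborel B = emeasure (distr lborel borel (\<lambda>x. s - x)) B"
    by simp
  also have "\<dots> = emeasure lborel {x. s - x \<in> B}"
    by (subst emeasure_distr) (auto simp: vimage_def)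
  finally show ?thesis ..
qed

lemma emeasure_flip_below:
  assumes "0 < s" "s < 1" and [measurable]: "B \<in> sets borel"
  shows "emeasure lborel {x \<in> {0..1}. flip_below s x \<in> B} = emeasure lborel ({0..1} \<inter> B)"
proof -
  let ?C = "B \<inter> {0<..<s}" and ?D = "B \<inter> ({0} \<union> {s..1})"
  have "{x \<in> {0..1}. flip_below s x \<in> B} = {x. s - x \<in> ?C} \<union> ?D"
    using assms by (auto simp: flip_below_def split: if_splits)
  then have "emeasure lborel {x \<in> {0..1}. flip_below s x \<in> B} = emeasure lborel {x. s - x \<in> ?C} + emeasure lborel ?D"
    using assms by (simp only:) (rule plus_emeasure[symmetric], auto)
  also have "\<dots> = emeasure lborel ?C + emeasure lborel ?D"
    by (subst emeasure_lborel_reflect) auto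
  also have "\<dots> = emeasure lborel (?C \<union> ?D)"
    by (rule plus_emeasure) auto
  also have "?C \<union> ?D = {0..1} \<inter> B"
    using assms by auto
  finally show ?thesis .
qed

lemma block_map_measurable:
  assumes "0 < s" "s < 1"
  shows "(\<lambda>x. (x, flip_below s x))
      \<in> restrict_space lborel {0..1} \<rightarrow>\<^sub>M restrict_space borel ({0..1} \<times> {0..1})"
proof (rule measurable_restrict_space2)
  show "(\<lambda>x. (x, flip_below s x)) \<in> restrict_space lborel {0..1} \<rightarrow>\<^sub>M borel"
    by (rule measurable_restrict_space1) (simp add: borel_prod[symmetric])
qed (use assms in \<open>auto simp: space_restrict_space flip_below_def\<close>)

lemma permuton_block:
  assumes "0 < s" "s < 1"
  shows "permuton (block_permuton s)"
proof -
  let ?L = "restrict_space lborel {0..1::real}" and ?R = "restrict_space borel ({0..1::real} \<times> {0..1::real})"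
  note m = block_map_measurable[OF assms]
  have "prob_space ?L"
    by (rule prob_spaceI) (simp add: space_restrict_space emeasure_restrict_space)
  have fs: "fst \<in> borel_measurable ?R" "snd \<in> borel_measurable ?R"
    by (auto simp: borel_prod[symmetric] intro!: measurable_restrict_space1)
  have coord: "distr (block_permuton s) borel f = uniform_measure lborel {0..1}"
    if "f \<in> borel_measurable ?R"
      and e: "\<And>B. B \<in> sets borel \<Longrightarrow> emeasure lborel {x \<in> {0..1}. f (x, flip_below s x) \<in> B} = emeasure lborel ({0..1} \<inter> B)"
    for f :: "real \<times> real \<Rightarrow> real"
  proof (rule measure_eqI)
    fix B assume "B \<in> sets (distr (block_permuton s) borel f)"
    then have B: "B \<in> sets borel" by simp
    have fm: "(\<lambda>x. f (x, flip_below s x)) \<in> borel_measurable ?L"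
      by (rule measurable_compose[OF m that(1)])
    have "emeasure (distr (block_permuton s) borel f) B = emeasure (distr ?L borel (\<lambda>x. f (x, flip_below s x))) B"
      unfolding block_permuton_def by (subst distr_distr[OF that(1) m]) (simp add: comp_def)
    also have "\<dots> = emeasure ?L {x \<in> {0..1}. f (x, flip_below s x) \<in> B}"
      using fm B by (subst emeasure_distr) (auto simp: space_restrict_space intro!: arg_cong[of _ _ "emeasure ?L"])
    also have "\<dots> = emeasure lborel {x \<in> {0..1}. f (x, flip_below s x) \<in> B}"
      by (rule emeasure_restrict_space) auto
    also have "\<dots> = emeasure (uniform_measure lborel {0..1}) B"
      unfolding e[OF B] using B by (simp add: divide_ennreal_def)
    finally show "emeasure (distr (block_permuton s) borel f) B = emeasure (uniform_measure lborel {0..1}) B" .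
  qed simp
  have "distr (block_permuton s) borel fst = uniform_measure lborel {0..1}"
    by (rule coord[OF fs(1)]) (auto intro!: arg_cong[of _ _ "emeasure lborel"])
  moreover have "distr (block_permuton s) borel snd = uniform_measure lborel {0..1}"
    by (rule coord[OF fs(2)]) (simp only: snd_conv emeasure_flip_below[OF assms])
  moreover have "prob_space (block_permuton s)"
    unfolding block_permuton_def by (rule prob_space.prob_space_distr[OF \<open>prob_space ?L\<close> m])
  ultimately show ?thesis
    by (simp add: permuton_def) (simp add: block_permuton_def)
qed

lemma AE_block_permuton:
  assumes "0 < s" "s < 1"
  shows "AE p in block_permuton s. snd p = flip_below s (fst p)"
  unfolding block_permuton_def
proof (subst AE_distr_iff[OF block_map_measurable[OF assms]])
  let ?R = "restrict_space borel ({0..1::real} \<times> {0..1::real})"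
  have [measurable]: "fst \<in> borel_measurable ?R" "snd \<in> borel_measurable ?R"
    by (auto simp: borel_prod[symmetric] intro!: measurable_restrict_space1)
  show "{p \<in> space ?R. snd p = flip_below s (fst p)} \<in> sets ?R"
    by measurable
qed simp

text \<open>
  With \<open>h\<close> the indicator of the decreasing block, two points are discordant exactly if both lie in
  the block. So the kernel is \<open>1 - h p * h q\<close> almost everywhere, and the densities are polynomials in
  the measure \<open>s\<close> of the block: a \<open>321\<close> pattern has all its points in the block, a \<open>123\<close> pattern at
  most one.
\<close>

lemma pattern_density_block:
  assumes "0 < s" "s < 1"
  shows "pattern_density [1, 2, 3] (block_permuton s) = 1 - 3 * s\<^sup>2 + 2 * s ^ 3"
    and "pattern_density [3, 2, 1] (block_permuton s) = s ^ 3"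
proof -
  interpret permuton_space "block_permuton s"
    by unfold_locales (rule permuton_block[OF assms])
  let ?\<gamma> = "block_permuton s"
  define h where "h p = (of_bool (0 < fst p \<and> fst p < s) :: real)" for p :: "real \<times> real"
  have hm [measurable]: "h \<in> borel_measurable ?\<gamma>"
    unfolding h_def by measurable
  have "(\<integral>p. h p \<partial>?\<gamma>) = (\<integral>p. indicator {0<..<s} (fst p) \<partial>?\<gamma>)"
    by (intro Bochner_Integration.integral_cong) (auto simp: h_def)
  also have "\<dots> = (\<integral>x. indicator {0<..<s} x \<partial>distr ?\<gamma> borel fst)"
    by (rule integral_distr[symmetric]) auto
  also have "\<dots> = measure (uniform_measure lborel {0..1}) {0<..<s}"
    using permuton unfolding permuton_def by simp
  also have "\<dots> = s"
    using assms by (subst measure_uniform_measure) (auto simp: Int_absorb1 subset_eq)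
  finally have int: "(\<integral>p. h p \<partial>?\<gamma>) = s" .
  have b: "bounded3 (\<lambda>x y z. h x)" "bounded3 (\<lambda>x y z. h y)" "bounded3 (\<lambda>x y z. h z)"
    by (rule bounded3_coord[of _ 1]; simp add: h_def)+
  note bdd = bounded3_intros b
  have km: "(\<lambda>(p, q). h p * h q) \<in> borel_measurable (?\<gamma> \<Otimes>\<^sub>M ?\<gamma>)" "(\<lambda>(p, q). 1 - h p * h q) \<in> borel_measurable (?\<gamma> \<Otimes>\<^sub>M ?\<gamma>)"
    unfolding split_beta' by measurable
  have kernel: "AE p in ?\<gamma>. AE q in ?\<gamma>. of_bool (concordant p q) = 1 - h p * h q"
    using AE_block_permuton[OF assms] AE_space
  proof eventually_elim
    fix p assume p: "snd p = flip_below s (fst p)" "p \<in> space ?\<gamma>"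
    have sp: "space ?\<gamma> = {0..1} \<times> {0..1}"
      by (simp add: block_permuton_def space_restrict_space)
    show "AE q in ?\<gamma>. of_bool (concordant p q) = 1 - h p * h q"
      using AE_block_permuton[OF assms] AE_coord_neq(1)[of "fst p"] AE_space
    proof eventually_elim
      fix q assume "snd q = flip_below s (fst q)" "fst q \<noteq> fst p" "q \<in> space ?\<gamma>"
      with p show "of_bool (concordant p q) = 1 - h p * h q"
        unfolding sp by (auto simp: concordant_def h_def flip_below_def mem_Times_iff split: if_splits)
    qed
  qed
  have "pattern_density [1, 2, 3] ?\<gamma> = triangle_density (\<lambda>p q. 1 - h p * h q)"
    unfolding pattern_density_123
    by (rule triangle_density_cong_AE[OF measurable_kernel km(2) kernel]) (auto simp: h_def)
  also have "\<dots> = integral3 (\<lambda>x y z. (1 - (h x * h y + h y * h z + h x * h z)) + 2 * (h x * h y * h z))"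
    unfolding triangle_density_def by (intro arg_cong[of _ _ integral3] ext) (auto simp: h_def)
  also have "\<dots> = (integral3 (\<lambda>x y z. 1) - (integral3 (\<lambda>x y z. h x * h y) + integral3 (\<lambda>x y z. h y * h z) + integral3 (\<lambda>x y z. h x * h z)))
      + integral3 (\<lambda>x y z. 2 * (h x * h y * h z))"
    by (subst integral3_add integral3_diff, (intro bdd)+)+ simp
  also have "\<dots> = 1 - 3 * s\<^sup>2 + 2 * s ^ 3"
    by (simp add: integral3_def prob_space int power2_eq_square power3_eq_cube mult.assoc)
  finally show "pattern_density [1, 2, 3] ?\<gamma> = 1 - 3 * s\<^sup>2 + 2 * s ^ 3" .
  have "pattern_density [3, 2, 1] ?\<gamma> = triangle_density (\<lambda>p q. h p * h q)"
    unfolding pattern_density_321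
  proof (rule triangle_density_cong_AE[OF graphon.measurable_kernel[OF graphon_complement] km(1)])
    show "AE p in ?\<gamma>. AE q in ?\<gamma>. 1 - of_bool (concordant p q) = h p * h q"
      using kernel
    proof eventually_elim
      case (elim p)
      then show ?case by eventually_elim simp
    qed
  qed (auto simp: h_def)
  also have "\<dots> = integral3 (\<lambda>x y z. h x * (h y * h z))"
    unfolding triangle_density_def by (intro arg_cong[of _ _ integral3] ext) (auto simp: h_def)
  also have "\<dots> = s ^ 3"
    by (simp add: integral3_def int power3_eq_cube)
  finally show "pattern_density [3, 2, 1] ?\<gamma> = s ^ 3" .
qed

text \<open>
  The equation for \<open>s\<close> amounts to \<open>s\<^sup>2 (3 - s) = 1\<close>, whose left side increases on \<open>[0, 1]\<close> and is
  still below \<open>1\<close> at \<open>0.6527\<close>.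
\<close>

lemma root_cube_gt:
  fixes s :: real
  assumes "0 < s" "s < 1" "s ^ 3 = (1 - s) ^ 3 + 3 * s * (1 - s)\<^sup>2"
  shows "278 / 1000 < s ^ 3"
proof -
  have s: "s\<^sup>2 * (3 - s) = 1"
    using assms(3) by (simp add: power2_eq_square power3_eq_cube algebra_simps)
  have "6527 / 10000 < s"
  proof (rule ccontr)
    assume "\<not> 6527 / 10000 < s"
    then have c: "s \<le> 6527 / 10000" by simp
    have "s * s \<le> 6527 / 10000 * s"
      using c assms by (intro mult_right_mono) auto
    then have "0 \<le> (6527 / 10000 - s) * (3 * (6527 / 10000 + s) - ((6527 / 10000)\<^sup>2 + 6527 / 10000 * s + s * s))"
      using c assms by (intro mult_nonneg_nonneg) (auto simp: power2_eq_square)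
    also have "\<dots> = (6527 / 10000)\<^sup>2 * (3 - 6527 / 10000) - s\<^sup>2 * (3 - s)"
      by (simp add: power2_eq_square field_simps)
    finally show False
      using s by (simp add: power2_eq_square)
  qed
  then have "(6527 / 10000) ^ 3 < s ^ 3"
    by (intro power_strict_mono) auto
  then show ?thesis
    by (simp add: power3_eq_cube)
qed

section \<open>Permutons near the corner point\<close>

theorem lemma17:
  fixes s r :: real
  assumes "0 < s" and "s < 1"
    and "s ^ 3 = (1 - s) ^ 3 + 3 * s * (1 - s)\<^sup>2"
    and "r = s ^ 3"
  shows "\<exists>N \<eta>. openin (top_of_set (feasible_region [1,2,3] [3,2,1])) N \<and> (r, r) \<in> N \<and> \<eta> > 0 \<and>
           (\<forall>\<gamma>. permuton \<gamma> \<and> (pattern_density [1,2,3] \<gamma>, pattern_density [3,2,1] \<gamma>) \<in> N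
                \<longrightarrow> \<bar>pattern_density [1,2] \<gamma> - 1 / 2\<bar> \<ge> \<eta>)"
proof -
  define Q :: "(real \<times> real) set" where "Q = {278 / 1000<..} \<times> {278 / 1000<..}"
  let ?N = "feasible_region [1,2,3] [3,2,1] \<inter> Q"
  have "openin (top_of_set (feasible_region [1,2,3] [3,2,1])) ?N"
    by (rule openin_open_Int) (auto simp: Q_def intro: open_Times)
  moreover have "(r, r) \<in> ?N"
  proof -
    have "1 - 3 * s\<^sup>2 + 2 * s ^ 3 = r"
      using assms(3,4) by (simp add: power2_eq_square power3_eq_cube algebra_simps)
    then have "(r, r) \<in> feasible_region [1,2,3] [3,2,1]"
      using pattern_density_block[OF assms(1,2)] permuton_block[OF assms(1,2)] assms(4)
      unfolding feasible_region_def by (intro CollectI exI[of _ "block_permuton s"]) auto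
    then show ?thesis
      using root_cube_gt[OF assms(1-3)] assms(4) by (simp add: Q_def)
  qed
  moreover have "1 / 1000 \<le> \<bar>pattern_density [1,2] \<gamma> - 1 / 2\<bar>"
    if \<gamma>: "permuton \<gamma>" and N: "(pattern_density [1,2,3] \<gamma>, pattern_density [3,2,1] \<gamma>) \<in> ?N" for \<gamma>
  proof (rule ccontr)
    assume "\<not> 1 / 1000 \<le> \<bar>pattern_density [1,2] \<gamma> - 1 / 2\<bar>"
    interpret permuton_space \<gamma>
      by unfold_locales (rule \<gamma>)
    show False
      using clique_or_independent_density_small \<open>\<not> _\<close> N
      by (simp add: Q_def pattern_density_12[simplified] pattern_density_123[simplified] pattern_density_321[simplified])
  qed
  ultimately show ?thesis
    by (intro exI[of _ ?N] exI[of _ "1 / 1000"]) auto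
qed

end
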